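(* Let $\mathcal M$ be a smooth manifold endowed with a smooth right action $(m,a)\mapsto ma$ of a Lie group $G$ with Lie algebra $\mathfrak g$. Let $\mathcal G$ be the set of smooth maps from $\mathcal M$ into $G$, endowed with the binary map $\rhd$ given by $(f\rhd g)(m):=g\big(mf(m)\big)$, and let $\mathcal L$ be the vector space of smooth maps from $\mathcal M$ into $\mathfrak g$, endowed with the product $\rhd$ given by $(X\rhd Y)(m):=(\widetilde X.Y)(m)$, where $\widetilde X$ is the vector field on $\mathcal M$ associated to $X$. Then the product $\rhd$ on $\mathcal L$ is obtained from the product $\rhd$ on $\mathcal G$ by differentiation: for any $X,Y\in\mathcal L$ and any $m\in\mathcal M$, $$\frac{d}{dt}\Big|_{t=0}\frac{d}{ds}\Big|_{s=0}\big(\exp(tX)\rhd\exp(sY)\big)(m)=(X\rhd Y)(m).$$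
   Context: For $X\in\mathcal L$, the map $\exp(X)\in\mathcal G$ is defined pointwise by $\exp(X)(m):=\exp\big(X(m)\big)$, where $\exp:\mathfrak g\to G$ is the Lie group exponential. For $X\in\mathcal L$, the vector field $\widetilde X$ on $\mathcal M$ is defined on smooth functions $\varphi$ (scalar-valued, or with values in a finite-dimensional vector space such as $\mathfrak g$) by $$(\widetilde X.\varphi)(m):=\frac{d}{dt}\Big|_{t=0}\varphi\Big(m\exp\big(tX(m)\big)\Big).$$ The derivative in $s$ at $s=0$ of a smooth curve in $G$ passing through the unit $e$ at $s=0$ is regarded as an element of $T_eG=\mathfrak g$. *)

theory Defs
  imports "HOL-Analysis.Analysis"
begin

section \<open>Smooth maps between finite-dimensional spaces\<close>

text \<open>The class \<open>euclidean_space\<close> of the library minus the requirement that the basis be nonempty,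
  so that manifolds and Lie groups of dimension 0 are included.\<close>

class euclidean_model = real_inner +
  assumes ex_orthonormal_basis:
    "\<exists>B. finite B \<and> (\<forall>u\<in>B. \<forall>v\<in>B. inner u v = (if u = v then 1 else 0)) \<and>
      (\<forall>x. (\<forall>u\<in>B. inner x u = 0) \<longleftrightarrow> x = 0)"

instance euclidean_space \<subseteq> euclidean_model
proof
  show "\<exists>B :: 'a set. finite B \<and> (\<forall>u\<in>B. \<forall>v\<in>B. inner u v = (if u = v then 1 else 0)) \<and>
      (\<forall>x. (\<forall>u\<in>B. inner x u = 0) \<longleftrightarrow> x = 0)"
    by (rule exI [of _ Basis]) (simp add: inner_Basis euclidean_all_zero_iff)
qed

text \<open>\<open>C_on k S f\<close> says that \<open>f\<close> is of class \<open>C\<^sup>k\<close> on \<open>S\<close>. It is meant for open \<open>S\<close> in a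
  finite-dimensional space, where continuity of the derivative as a map into the linear maps amounts
  to continuity of all directional derivatives.\<close>

primrec C_on :: "nat \<Rightarrow> 'a::real_normed_vector set \<Rightarrow> ('a \<Rightarrow> 'b::real_normed_vector) \<Rightarrow> bool" where
  "C_on 0 S f \<longleftrightarrow> continuous_on S f"
| "C_on (Suc k) S f \<longleftrightarrow> (\<forall>x\<in>S. f differentiable (at x)) \<and>
     (\<forall>v. C_on k S (\<lambda>x. frechet_derivative f (at x) v))"

definition smooth_on :: "'a::real_normed_vector set \<Rightarrow> ('a \<Rightarrow> 'b::real_normed_vector) \<Rightarrow> bool" where
  "smooth_on S f \<longleftrightarrow> (\<forall>k. C_on k S f)"


section \<open>Smooth manifolds\<close>

text \<open>A chart is a pair of its domain and its coordinate map; the values of the coordinate map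
  outside the domain are irrelevant.\<close>

type_synonym ('m, 'b) chart = "'m set \<times> ('m \<Rightarrow> 'b)"

definition chart_inv :: "('m, 'b) chart \<Rightarrow> 'b \<Rightarrow> 'm" where
  "chart_inv c = inv_into (fst c) (snd c)"

definition is_chart :: "('m::topological_space, 'b::real_normed_vector) chart \<Rightarrow> bool" where
  "is_chart c \<longleftrightarrow> open (fst c) \<and> open (snd c ` fst c) \<and>
     homeomorphism (fst c) (snd c ` fst c) (snd c) (chart_inv c)"

definition charts_at :: "('m, 'b) chart set \<Rightarrow> 'm \<Rightarrow> ('m, 'b) chart set" where
  "charts_at A p = {c \<in> A. p \<in> fst c}"

text \<open>The topology of the manifold is that of its type, which is required to be Hausdorff and second
  countable. The smooth structure is the one generated by the atlas, which need not be maximal.\<close>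

definition smooth_manifold ::
  "('m::{t2_space,second_countable_topology}, 'b::euclidean_model) chart set \<Rightarrow> bool" where
  "smooth_manifold A \<longleftrightarrow> (\<forall>c\<in>A. is_chart c) \<and> (\<Union>c\<in>A. fst c) = UNIV \<and>
     (\<forall>c\<in>A. \<forall>d\<in>A. smooth_on (snd c ` (fst c \<inter> fst d)) (snd d \<circ> chart_inv c))"

definition vector_atlas :: "('b, 'b) chart set" where
  "vector_atlas = {(UNIV, id)}"

definition prod_atlas ::
  "('m, 'b) chart set \<Rightarrow> ('n, 'c) chart set \<Rightarrow> ('m \<times> 'n, 'b \<times> 'c) chart set" where
  "prod_atlas A B = {(fst c \<times> fst d, map_prod (snd c) (snd d)) |c d. c \<in> A \<and> d \<in> B}"

definition smooth_map ::
  "('m::topological_space, 'b::real_normed_vector) chart set \<Rightarrow>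
   ('n::topological_space, 'c::real_normed_vector) chart set \<Rightarrow> ('m \<Rightarrow> 'n) \<Rightarrow> bool" where
  "smooth_map A B f \<longleftrightarrow> continuous_on UNIV f \<and>
     (\<forall>c\<in>A. \<forall>d\<in>B. smooth_on (snd c ` (fst c \<inter> f -` fst d)) (snd d \<circ> f \<circ> chart_inv c))"

text \<open>A tangent vector at \<open>p\<close> is the family of its coordinate vectors in all the charts around \<open>p\<close>,
  which correspond to each other under the derivatives of the transition maps. In the charts not
  containing \<open>p\<close> the family is 0 by convention. The linear structure is pointwise.\<close>

definition tangent_space ::
  "('m, 'b::real_normed_vector) chart set \<Rightarrow> 'm \<Rightarrow> (('m, 'b) chart \<Rightarrow> 'b) set" where
  "tangent_space A p = {v. (\<forall>c. c \<notin> charts_at A p \<longrightarrow> v c = 0) \<and>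
     (\<forall>c\<in>charts_at A p. \<forall>d\<in>charts_at A p.
        v d = frechet_derivative (snd d \<circ> chart_inv c) (at (snd c p)) (v c))}"

text \<open>\<open>has_velocity A p \<gamma> v\<close>: the curve \<open>\<gamma>\<close> passes through \<open>p\<close> at time 0, is differentiable there,
  and has velocity \<open>v\<close>. Continuity ensures that \<open>\<gamma>\<close> stays in the chart domains near time 0.\<close>

definition has_velocity ::
  "('m::topological_space, 'b::real_normed_vector) chart set \<Rightarrow> 'm \<Rightarrow> (real \<Rightarrow> 'm) \<Rightarrow>
   (('m, 'b) chart \<Rightarrow> 'b) \<Rightarrow> bool" where
  "has_velocity A p \<gamma> v \<longleftrightarrow> \<gamma> 0 = p \<and> isCont \<gamma> 0 \<and> v \<in> tangent_space A p \<and>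
     (\<forall>c\<in>charts_at A p. ((\<lambda>s. snd c (\<gamma> s)) has_vector_derivative v c) (at 0))"

definition velocity ::
  "('m::topological_space, 'b::real_normed_vector) chart set \<Rightarrow> 'm \<Rightarrow> (real \<Rightarrow> 'm) \<Rightarrow>
   (('m, 'b) chart \<Rightarrow> 'b)" where
  "velocity A p \<gamma> = (THE v. has_velocity A p \<gamma> v)"

text \<open>Differentiation at time 0 of a curve in the fixed vector space \<open>tangent_space A p\<close>. The
  coordinates in any one chart around \<open>p\<close> identify this space with the model space, so that
  differentiation is componentwise; the same applies to smoothness in \<open>smooth_tangent_maps\<close>.\<close>

definition has_deriv_in_tangent_space ::
  "('m, 'b::real_normed_vector) chart set \<Rightarrow> 'm \<Rightarrow> (real \<Rightarrow> ('m, 'b) chart \<Rightarrow> 'b) \<Rightarrow>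
   (('m, 'b) chart \<Rightarrow> 'b) \<Rightarrow> bool" where
  "has_deriv_in_tangent_space A p V D \<longleftrightarrow>
     (\<forall>t. V t \<in> tangent_space A p) \<and> D \<in> tangent_space A p \<and>
     (\<forall>c\<in>charts_at A p. ((\<lambda>t. V t c) has_vector_derivative D c) (at 0))"

definition smooth_tangent_maps ::
  "('m::topological_space, 'b::real_normed_vector) chart set \<Rightarrow>
   ('g, 'c::real_normed_vector) chart set \<Rightarrow> 'g \<Rightarrow> ('m \<Rightarrow> ('g, 'c) chart \<Rightarrow> 'c) set" where
  "smooth_tangent_maps A B p = {X. (\<forall>m. X m \<in> tangent_space B p) \<and>
     (\<forall>c\<in>charts_at B p. smooth_map A vector_atlas (\<lambda>m. X m c))}"


section \<open>Lie groups and their actions\<close>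

definition lie_group ::
  "('g::{t2_space,second_countable_topology}, 'c::euclidean_model) chart set \<Rightarrow>
   ('g \<Rightarrow> 'g \<Rightarrow> 'g) \<Rightarrow> 'g \<Rightarrow> ('g \<Rightarrow> 'g) \<Rightarrow> bool" where
  "lie_group A mul e ginv \<longleftrightarrow> smooth_manifold A \<and> group mul e ginv \<and>
     smooth_map (prod_atlas A A) A (\<lambda>(a, b). mul a b) \<and> smooth_map A A ginv"

definition smooth_right_action ::
  "('m::{t2_space,second_countable_topology}, 'b::euclidean_model) chart set \<Rightarrow>
   ('g::{t2_space,second_countable_topology}, 'c::euclidean_model) chart set \<Rightarrow>
   ('g \<Rightarrow> 'g \<Rightarrow> 'g) \<Rightarrow> 'g \<Rightarrow> ('m \<Rightarrow> 'g \<Rightarrow> 'm) \<Rightarrow> bool" where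
  "smooth_right_action AM AG mul e act \<longleftrightarrow>
     smooth_map (prod_atlas AM AG) AM (\<lambda>(m, a). act m a) \<and>
     (\<forall>m. act m e = m) \<and> (\<forall>m a b. act (act m a) b = act m (mul a b))"

text \<open>The Lie algebra, as a vector space, is \<open>tangent_space A e\<close>. The exponential of \<open>Z\<close> is the value
  at time 1 of the one-parameter subgroup with initial velocity \<open>Z\<close>.\<close>

definition one_param_subgroup ::
  "('g::topological_space, 'c::real_normed_vector) chart set \<Rightarrow> ('g \<Rightarrow> 'g \<Rightarrow> 'g) \<Rightarrow>
   (real \<Rightarrow> 'g) \<Rightarrow> bool" where
  "one_param_subgroup A mul \<gamma> \<longleftrightarrow>
     smooth_map vector_atlas A \<gamma> \<and> (\<forall>s t. \<gamma> (s + t) = mul (\<gamma> s) (\<gamma> t))"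

definition lie_exp ::
  "('g::topological_space, 'c::real_normed_vector) chart set \<Rightarrow> ('g \<Rightarrow> 'g \<Rightarrow> 'g) \<Rightarrow> 'g \<Rightarrow>
   (('g, 'c) chart \<Rightarrow> 'c) \<Rightarrow> 'g" where
  "lie_exp A mul e Z = (THE \<gamma>. one_param_subgroup A mul \<gamma> \<and> has_velocity A e \<gamma> Z) 1"

definition scale_tangent :: "real \<Rightarrow> ('k \<Rightarrow> 'c::real_vector) \<Rightarrow> 'k \<Rightarrow> 'c" where
  "scale_tangent t Z = (\<lambda>c. t *\<^sub>R Z c)"

definition scale_map :: "real \<Rightarrow> ('m \<Rightarrow> 'k \<Rightarrow> 'c::real_vector) \<Rightarrow> 'm \<Rightarrow> 'k \<Rightarrow> 'c" where
  "scale_map t X = (\<lambda>m. scale_tangent t (X m))"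

definition exp_map ::
  "('g::topological_space, 'c::real_normed_vector) chart set \<Rightarrow> ('g \<Rightarrow> 'g \<Rightarrow> 'g) \<Rightarrow> 'g \<Rightarrow>
   ('m \<Rightarrow> ('g, 'c) chart \<Rightarrow> 'c) \<Rightarrow> 'm \<Rightarrow> 'g" where
  "exp_map A mul e X = (\<lambda>m. lie_exp A mul e (X m))"

definition rhd_group :: "('m \<Rightarrow> 'g \<Rightarrow> 'm) \<Rightarrow> ('m \<Rightarrow> 'g) \<Rightarrow> ('m \<Rightarrow> 'g) \<Rightarrow> 'm \<Rightarrow> 'g" where
  "rhd_group act f g = (\<lambda>m. g (act m (f m)))"

text \<open>The vector field associated to \<open>X\<close>, as an operator on functions on the manifold.\<close>

definition assoc_vector_field ::
  "('g::topological_space, 'c::real_normed_vector) chart set \<Rightarrow> ('g \<Rightarrow> 'g \<Rightarrow> 'g) \<Rightarrow> 'g \<Rightarrow>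
   ('m \<Rightarrow> 'g \<Rightarrow> 'm) \<Rightarrow> ('m \<Rightarrow> ('g, 'c) chart \<Rightarrow> 'c) \<Rightarrow>
   ('m \<Rightarrow> 'w::real_normed_vector) \<Rightarrow> 'm \<Rightarrow> 'w" where
  "assoc_vector_field A mul e act X \<phi> = (\<lambda>m.
     vector_derivative (\<lambda>t. \<phi> (act m (lie_exp A mul e (scale_tangent t (X m))))) (at 0))"

text \<open>The vector field is applied to a map into the Lie algebra componentwise.\<close>

definition rhd_lie ::
  "('g::topological_space, 'c::real_normed_vector) chart set \<Rightarrow> ('g \<Rightarrow> 'g \<Rightarrow> 'g) \<Rightarrow> 'g \<Rightarrow>
   ('m \<Rightarrow> 'g \<Rightarrow> 'm) \<Rightarrow> ('m \<Rightarrow> ('g, 'c) chart \<Rightarrow> 'c) \<Rightarrow> ('m \<Rightarrow> ('g, 'c) chart \<Rightarrow> 'c) \<Rightarrow>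
   'm \<Rightarrow> ('g, 'c) chart \<Rightarrow> 'c" where
  "rhd_lie A mul e act X Y = (\<lambda>m c. assoc_vector_field A mul e act X (\<lambda>m'. Y m' c) m)"

end

(* The curve s |-> exp(sZ) is the one-parameter subgroup with velocity Z, so the inner derivative is
   Y(m exp(tX(m))) and the outer one is the derivative of Y along the curve t |-> m exp(tX(m)), which
   is the definition of the right-hand side. The work lies in the existence and uniqueness of
   one-parameter subgroups. In a chart around the unit they are the solutions of u' = f(u) for the
   left invariant vector field f; the local solution (Picard) is a local homomorphism because
   t |-> u(s + t) and t |-> u(s)u(t) solve the same initial value problem, and it extends to the real
   line by doubling. *)

theory Submission
  imports Defs
begin

section \<open>Finite-dimensional spaces\<close>

text \<open>\<open>lie_exp\<close> and \<open>velocity\<close> are definite descriptions, so nothing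
  can be computed with them before existence and uniqueness are known. Two features of the setting
  shape the way there. \<open>C_on\<close> speaks only of derivatives in fixed directions; wherever
  the full derivative matters, vectors are expanded in a finite orthonormal basis, and the same
  expansion yields completeness. Moreover a chart covers only a neighbourhood of the unit, so
  differential equations are compared on short intervals only, and the group law does the rest. In
  particular the regularity of the doubled curve at a time \<open>s\<close> comes from writing it
  near \<open>s\<close> as a left translate of the local solution. On the right-hand side,
  \<open>vector_derivative\<close> says something only about differentiable curves, so the chain
  rule along the orbit of \<open>m\<close> is still required, and the outer derivative must be shown
  to obey the transition rule that defines \<open>tangent_space\<close>.\<close>

lemma finite_basis_expansion:
  "\<exists>B :: 'a::euclidean_model set. finite B \<and> (\<forall>u\<in>B. norm u = 1) \<and>
    (\<forall>x. (\<Sum>b\<in>B. inner x b *\<^sub>R b) = x)"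
proof -
  obtain B :: "'a set" where fin: "finite B"
    and ortho: "\<And>u v. u \<in> B \<Longrightarrow> v \<in> B \<Longrightarrow> inner u v = (if u = v then 1 else 0)"
    and zero: "\<And>x. (\<forall>u\<in>B. inner x u = 0) \<longleftrightarrow> x = 0"
    using exE[OF ex_orthonormal_basis] by metis
  have "(\<Sum>b\<in>B. inner x b *\<^sub>R b) = x" for x
  proof -
    have "inner ((\<Sum>b\<in>B. inner x b *\<^sub>R b) - x) u = 0" if "u \<in> B" for u
    proof -
      have "inner (\<Sum>b\<in>B. inner x b *\<^sub>R b) u = (\<Sum>b\<in>B. if b = u then inner x b else 0)"
        unfolding inner_sum_left by (rule sum.cong) (auto simp: ortho that)
      then show ?thesis using fin that by (simp add: inner_diff_left)
    qed
    then have "(\<Sum>b\<in>B. inner x b *\<^sub>R b) - x = 0" by (intro zero[THEN iffD1] ballI)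
    then show ?thesis by simp
  qed
  moreover have "norm u = 1" if "u \<in> B" for u
    using ortho[OF that that] by (simp add: norm_eq_sqrt_inner)
  ultimately show ?thesis using fin by blast
qed

text \<open>Coordinates in a finite orthonormal basis are Cauchy, hence converge. Completeness is
  what the integral and the fixed point theorem behind the Picard solution rest on.\<close>

instance euclidean_model \<subseteq> banach
proof
  fix X :: "nat \<Rightarrow> 'a" assume X: "Cauchy X"
  obtain B :: "'a set" where B: "finite B" "\<And>u. u \<in> B \<Longrightarrow> norm u = 1"
      "\<And>x. (\<Sum>b\<in>B. inner x b *\<^sub>R b) = x"
    using finite_basis_expansion by blast
  have "\<exists>l. (\<lambda>n. inner (X n) b) \<longlonglongrightarrow> l" for b
  proof -
    have "Cauchy (\<lambda>n. inner (X n) b)"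
      using bounded_linear.Cauchy[OF bounded_linear_inner_left X] .
    then show ?thesis using Cauchy_convergent_iff convergent_def by blast
  qed
  then obtain l where l: "\<And>b. (\<lambda>n. inner (X n) b) \<longlonglongrightarrow> l b" by metis
  have "(\<lambda>n. \<Sum>b\<in>B. inner (X n) b *\<^sub>R b) \<longlonglongrightarrow> (\<Sum>b\<in>B. l b *\<^sub>R b)"
    by (intro tendsto_intros l)
  then show "convergent X" unfolding B(3) convergent_def by blast
qed

text \<open>Products occur as intermediate spaces: multiplication in a chart is a map on
  \<open>'c \<times> 'c\<close>, and the chain rule \<open>C_on_compose\<close> asks for a basis
  there.\<close>

instance prod :: (euclidean_model, euclidean_model) euclidean_model
proof
  obtain B :: "'a set" where B: "finite B" "\<forall>u\<in>B. \<forall>v\<in>B. inner u v = (if u = v then 1 else 0)"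
      "\<forall>x. (\<forall>u\<in>B. inner x u = 0) \<longleftrightarrow> x = 0"
    using ex_orthonormal_basis by auto
  obtain C :: "'b set" where C: "finite C" "\<forall>u\<in>C. \<forall>v\<in>C. inner u v = (if u = v then 1 else 0)"
      "\<forall>x. (\<forall>u\<in>C. inner x u = 0) \<longleftrightarrow> x = 0"
    using ex_orthonormal_basis by auto
  \<comment> \<open>The two embedded bases could meet only in \<open>(0, 0)\<close>. As 0 is not a
    unit vector, mixed pairs are distinct, in accordance with their inner product 0.\<close>
  have n0: "0 \<notin> B" "0 \<notin> C" using B(2) C(2) by fastforce+
  let ?D = "(\<lambda>b. (b, 0)) ` B \<union> (\<lambda>b. (0, b)) ` C :: ('a \<times> 'b) set"
  have 1: "finite ?D" using B(1) C(1) by simp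
  have 2: "\<forall>u\<in>?D. \<forall>v\<in>?D. inner u v = (if u = v then 1 else 0)"
    using n0 by (auto simp: inner_prod_def B(2)[rule_format] C(2)[rule_format] split: if_splits)
  have 3: "\<forall>x. (\<forall>u\<in>?D. inner x u = 0) \<longleftrightarrow> x = 0"
  proof
    fix x :: "'a \<times> 'b"
    have "(\<forall>u\<in>?D. inner x u = 0) \<longleftrightarrow>
        (\<forall>u\<in>B. inner (fst x) u = 0) \<and> (\<forall>u\<in>C. inner (snd x) u = 0)"
      by (simp add: ball_Un inner_prod_def)
    also have "\<dots> \<longleftrightarrow> x = 0" using B(3) C(3) by (simp add: prod_eq_iff)
    finally show "(\<forall>u\<in>?D. inner x u = 0) \<longleftrightarrow> x = 0" .
  qed
  show "\<exists>B :: ('a \<times> 'b) set. finite B \<and> (\<forall>u\<in>B. \<forall>v\<in>B. inner u v = (if u = v then 1 else 0)) \<and>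
      (\<forall>x. (\<forall>u\<in>B. inner x u = 0) \<longleftrightarrow> x = 0)"
    by (rule exI[of _ ?D], intro conjI 1 2 3)
qed


section \<open>Calculus of \<open>C\<^sup>k\<close> maps\<close>

lemma frechet_derivative_cong_open:
  assumes "open S" "x \<in> S" "\<And>y. y \<in> S \<Longrightarrow> f y = g y"
  shows "frechet_derivative f (at x) = frechet_derivative g (at x)"
proof -
  have "(f has_derivative D) (at x) \<longleftrightarrow> (g has_derivative D) (at x)" for D
    using assms by (metis has_derivative_transform_within_open)
  then show ?thesis by (simp add: frechet_derivative_def)
qed

lemma C_on_cong:
  assumes "open S" "\<And>x. x \<in> S \<Longrightarrow> f x = g x" "C_on k S f"
  shows "C_on k S g"
  using assms(2,3)
proof (induction k arbitrary: f g)
  case 0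
  then show ?case by (auto cong: continuous_on_cong)
next
  case (Suc k)
  have "g differentiable at x" if "x \<in> S" for x
    using Suc.prems that assms(1) unfolding differentiable_def C_on.simps
    by (metis has_derivative_transform_within_open)
  moreover have "C_on k S (\<lambda>x. frechet_derivative g (at x) v)" for v
  proof (rule Suc.IH)
    show "frechet_derivative f (at x) v = frechet_derivative g (at x) v" if "x \<in> S" for x
      using frechet_derivative_cong_open[OF assms(1) that Suc.prems(1)] by simp
    show "C_on k S (\<lambda>x. frechet_derivative f (at x) v)" using Suc.prems by simp
  qed
  ultimately show ?case by simp
qed

lemma C_on_subset: "C_on k S f \<Longrightarrow> T \<subseteq> S \<Longrightarrow> C_on k T f"
  by (induction k arbitrary: f) (auto intro: continuous_on_subset)

lemma smooth_on_subset: "smooth_on S f \<Longrightarrow> T \<subseteq> S \<Longrightarrow> smooth_on T f"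
  unfolding smooth_on_def using C_on_subset by blast

lemma smooth_on_cong:
  "open S \<Longrightarrow> (\<And>x. x \<in> S \<Longrightarrow> f x = g x) \<Longrightarrow> smooth_on S f \<Longrightarrow> smooth_on S g"
  unfolding smooth_on_def using C_on_cong by blast

text \<open>Every condition at a point depends only on \<open>f\<close> near it. This serves curves
  whose explicit formula changes with the time at which they are examined.\<close>

lemma C_on_local:
  assumes "\<And>x. x \<in> S \<Longrightarrow> \<exists>T. open T \<and> x \<in> T \<and> C_on k T f"
  shows "C_on k S f"
  using assms
proof (induction k arbitrary: f)
  case 0
  have "isCont f x" if "x \<in> S" for x
    using 0[OF that] by (auto simp: continuous_on_eq_continuous_at)
  then show ?case by (simp add: continuous_at_imp_continuous_on)
next
  case (Suc k)
  have "C_on k S (\<lambda>x. frechet_derivative f (at x) v)" for v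
    by (rule Suc.IH) (use Suc.prems in fastforce)
  then show ?case using Suc.prems by fastforce
qed

lemma C_on_Suc_imp: "C_on (Suc k) S f \<Longrightarrow> C_on k S f"
proof (induction k arbitrary: f)
  case 0
  then show ?case
    by (auto intro!: continuous_at_imp_continuous_on differentiable_imp_continuous_within)
next
  case (Suc k)
  then show ?case by (metis C_on.simps(2))
qed

text \<open>Derivatives at a point are unique, so an explicit \<open>D\<close> may stand for
  \<open>frechet_derivative\<close>; openness lets \<open>C_on_cong\<close> carry the replacement to
  higher order.\<close>

lemma C_on_SucI:
  assumes "open S" "\<And>x. x \<in> S \<Longrightarrow> (f has_derivative D x) (at x)" "\<And>v. C_on k S (\<lambda>x. D x v)"
  shows "C_on (Suc k) S f"
proof -
  have eq: "D x = frechet_derivative f (at x)" if "x \<in> S" for x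
    using assms(2)[OF that] by (rule frechet_derivative_at)
  have "C_on k S (\<lambda>x. frechet_derivative f (at x) v)" for v
    by (rule C_on_cong[OF assms(1) _ assms(3)[of v]]) (simp add: eq)
  then show ?thesis using assms(2) by (auto simp: differentiable_def)
qed

lemma C_on_has_derivative:
  "C_on (Suc k) S f \<Longrightarrow> x \<in> S \<Longrightarrow> (f has_derivative frechet_derivative f (at x)) (at x)"
  by (simp add: frechet_derivative_works)

section \<open>Closure of \<open>C_on\<close> under algebraic operations and composition\<close>

lemma C_on_const: "open S \<Longrightarrow> C_on k S (\<lambda>x. a)"
proof (induction k arbitrary: a)
  case (Suc k)
  show ?case by (rule C_on_SucI[where D = "\<lambda>_ _. 0"]) (use Suc in auto)
qed simp

lemma C_on_add:
  assumes "open S" shows "C_on k S f \<Longrightarrow> C_on k S g \<Longrightarrow> C_on k S (\<lambda>x. f x + g x)"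
proof (induction k arbitrary: f g)
  case 0
  then show ?case by (simp add: continuous_on_add)
next
  case (Suc k)
  show ?case
  proof (rule C_on_SucI[OF assms])
    show "((\<lambda>x. f x + g x) has_derivative
        (\<lambda>v. frechet_derivative f (at x) v + frechet_derivative g (at x) v)) (at x)" if "x \<in> S" for x
      by (intro has_derivative_add C_on_has_derivative[OF Suc.prems(1) that]
          C_on_has_derivative[OF Suc.prems(2) that])
  qed (use Suc in simp)
qed

lemma C_on_bounded_linear:
  assumes "open S" "bounded_linear L" shows "C_on k S f \<Longrightarrow> C_on k S (\<lambda>x. L (f x))"
proof (induction k arbitrary: f)
  case 0
  then show ?case by (simp add: assms bounded_linear.continuous_on)
next
  case (Suc k)
  show ?case
  proof (rule C_on_SucI[OF assms(1)])
    show "((\<lambda>x. L (f x)) has_derivative (\<lambda>v. L (frechet_derivative f (at x) v))) (at x)"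
      if "x \<in> S" for x
      by (intro bounded_linear.has_derivative[OF assms(2)] C_on_has_derivative[OF Suc.prems(1) that])
  qed (use Suc in simp)
qed

lemma C_on_Pair:
  assumes "open S" "C_on k S f" "C_on k S g" shows "C_on k S (\<lambda>x. (f x, g x))"
proof -
  have "C_on k S (\<lambda>x. (f x, 0) + (0, g x))"
  proof (rule C_on_add[OF assms(1)])
    show "C_on k S (\<lambda>x. (f x, 0))"
      by (rule C_on_bounded_linear[OF assms(1) _ assms(2), where L = "\<lambda>y. (y, 0)"])
        (simp add: bounded_linear_Pair)
    show "C_on k S (\<lambda>x. (0, g x))"
      by (rule C_on_bounded_linear[OF assms(1) _ assms(3), where L = "\<lambda>y. (0, y)"])
        (simp add: bounded_linear_Pair)
  qed
  then show ?thesis by simp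
qed

lemma C_on_ident:
  assumes "open S" shows "C_on k S (\<lambda>x. x)"
proof (cases k)
  case (Suc n)
  show ?thesis unfolding Suc
    by (rule C_on_SucI[where D = "\<lambda>_ v. v"]) (use assms C_on_const in auto)
qed simp

lemma C_on_scaleR:
  fixes f :: "'a::real_normed_vector \<Rightarrow> real"
  assumes "open S" shows "C_on k S f \<Longrightarrow> C_on k S g \<Longrightarrow> C_on k S (\<lambda>x. f x *\<^sub>R g x)"
proof (induction k arbitrary: f g)
  case 0
  then show ?case by (simp add: continuous_on_scaleR)
next
  case (Suc k)
  show ?case
  proof (rule C_on_SucI[OF assms])
    show "((\<lambda>x. f x *\<^sub>R g x) has_derivative
        (\<lambda>v. f x *\<^sub>R frechet_derivative g (at x) v + frechet_derivative f (at x) v *\<^sub>R g x)) (at x)"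
      if "x \<in> S" for x
      by (intro has_derivative_scaleR C_on_has_derivative[OF Suc.prems(1) that]
          C_on_has_derivative[OF Suc.prems(2) that])
    show "C_on k S (\<lambda>x. f x *\<^sub>R frechet_derivative g (at x) v + frechet_derivative f (at x) v *\<^sub>R g x)"
      for v
      by (intro C_on_add[OF assms] Suc.IH C_on_Suc_imp[OF Suc.prems(1)] C_on_Suc_imp[OF Suc.prems(2)])
        (use Suc.prems in simp_all)
  qed
qed

lemma C_on_sum:
  assumes "open S" "finite I" "\<And>i. i \<in> I \<Longrightarrow> C_on k S (f i)"
  shows "C_on k S (\<lambda>x. \<Sum>i\<in>I. f i x)"
  using assms(2,3) by (induction I rule: finite_induct) (simp_all add: C_on_const C_on_add assms(1))

text \<open>The chain rule applies the derivative of \<open>g\<close> to a vector that varies with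
  \<open>x\<close>, while \<open>C_on\<close> controls that derivative in fixed directions only.
  Expanding the vector in a finite basis gives a sum of products, and the induction hypothesis
  applies to the derivative of \<open>g\<close> along each basis vector.\<close>

lemma C_on_compose:
  fixes f :: "'a::real_normed_vector \<Rightarrow> 'b::euclidean_model"
  assumes "open S" "f ` S \<subseteq> T"
  shows "C_on k S f \<Longrightarrow> C_on k T g \<Longrightarrow> C_on k S (\<lambda>x. g (f x))"
proof (induction k arbitrary: g)
  case 0
  then show ?case using assms(2) by (simp add: continuous_on_compose2)
next
  case (Suc k)
  obtain B :: "'b set" where B: "finite B" "\<And>u. u \<in> B \<Longrightarrow> norm u = 1"
      "\<And>x. (\<Sum>b\<in>B. inner x b *\<^sub>R b) = x"
    using finite_basis_expansion by blast
  show ?case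
  proof (rule C_on_SucI[OF assms(1)])
    fix x assume x: "x \<in> S"
    then have fx: "f x \<in> T" using assms(2) by blast
    let ?G = "frechet_derivative g (at (f x))" and ?F = "frechet_derivative f (at x)"
    have G: "(g has_derivative ?G) (at (f x))"
      by (rule C_on_has_derivative[OF Suc.prems(2) fx])
    interpret bounded_linear ?G using G has_derivative_bounded_linear by blast
    have "((\<lambda>x. g (f x)) has_derivative (\<lambda>v. ?G (?F v))) (at x)"
      by (rule has_derivative_compose[OF C_on_has_derivative[OF Suc.prems(1) x] G])
    moreover have "?G w = (\<Sum>b\<in>B. inner w b *\<^sub>R ?G b)" for w
      by (subst B(3)[of w, symmetric]) (simp only: sum scaleR)
    ultimately show "((\<lambda>x. g (f x)) has_derivative (\<lambda>v. \<Sum>b\<in>B.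
        inner (frechet_derivative f (at x) v) b *\<^sub>R frechet_derivative g (at (f x)) b)) (at x)"
      by (rule has_derivative_eq_rhs[OF _ ext])
  next
    fix v
    show "C_on k S (\<lambda>x. \<Sum>b\<in>B.
        inner (frechet_derivative f (at x) v) b *\<^sub>R frechet_derivative g (at (f x)) b)"
      using Suc.prems by (intro C_on_sum[OF assms(1) B(1)] C_on_scaleR[OF assms(1)]
          C_on_bounded_linear[OF assms(1) bounded_linear_inner_left] Suc.IH C_on_Suc_imp[OF Suc.prems(1)])
        simp_all
  qed
qed

text \<open>The sum \<open>M x\<close> of the norms of the derivatives along a basis bounds the
  operator norm and is continuous, so it is at most \<open>M x0 + 1\<close> near \<open>x0\<close>.
  The mean value inequality on the convex ball concludes.\<close>

lemma C_1_locally_lipschitz: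
  fixes f :: "'a::euclidean_model \<Rightarrow> 'b::real_normed_vector"
  assumes "open S" "C_on 1 S f" "x0 \<in> S"
  obtains r L where "0 < r" "0 < L" "cball x0 r \<subseteq> S" "L-lipschitz_on (cball x0 r) f"
proof -
  obtain B :: "'a set" where B: "finite B" "\<And>u. u \<in> B \<Longrightarrow> norm u = 1"
      "\<And>x. (\<Sum>b\<in>B. inner x b *\<^sub>R b) = x"
    using finite_basis_expansion by blast
  let ?D = "\<lambda>x. frechet_derivative f (at x)"
  define M where "M x = (\<Sum>b\<in>B. norm (?D x b))" for x
  have "continuous_on S M"
    unfolding M_def using assms(2) by (intro continuous_intros) simp
  then have "(M \<longlongrightarrow> M x0) (at x0)"
    using assms(1,3) by (simp add: continuous_on_eq_continuous_at isContD)
  then have "\<forall>\<^sub>F x in at x0. M x < M x0 + 1" by (rule order_tendstoD) simp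
  then obtain d where d: "d > 0" "\<And>x. x \<noteq> x0 \<Longrightarrow> dist x x0 < d \<Longrightarrow> M x < M x0 + 1"
    unfolding eventually_at by auto
  obtain d' where d': "d' > 0" "cball x0 d' \<subseteq> S" using assms open_contains_cball by blast
  \<comment> \<open>Half of \<open>d\<close> keeps the closed ball inside the open one on which
    \<open>M\<close> is controlled.\<close>
  define r where "r = min (d/2) d'"
  have r: "0 < r" "cball x0 r \<subseteq> S" using d d' by (auto simp: r_def)
  have Mb: "M x \<le> M x0 + 1" if "x \<in> cball x0 r" for x
    using d(2)[of x] d(1) that by (cases "x = x0") (auto simp: r_def dist_commute)
  have M0: "0 \<le> M x0" by (simp add: M_def sum_nonneg)
  have "norm (f x - f y) \<le> (M x0 + 1) * norm (x - y)" if "x \<in> cball x0 r" "y \<in> cball x0 r" for x y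
  proof (rule differentiable_bound[OF convex_cball _ _ that, where f' = ?D])
    fix x assume x: "x \<in> cball x0 r"
    have D: "(f has_derivative ?D x) (at x)"
      using C_on_has_derivative[of 0 S f x] assms(2) r x by auto
    then show "(f has_derivative ?D x) (at x within cball x0 r)"
      by (rule has_derivative_at_withinI)
    interpret bounded_linear "?D x" using D has_derivative_bounded_linear by blast
    have "norm (?D x w) \<le> M x * norm w" for w
    proof -
      have "norm (?D x w) = norm (\<Sum>b\<in>B. inner w b *\<^sub>R ?D x b)"
        by (subst B(3)[of w, symmetric]) (simp only: sum scaleR)
      also have "\<dots> \<le> (\<Sum>b\<in>B. norm w * norm (?D x b))"
      proof (intro order_trans[OF norm_sum] sum_mono)
        fix b assume "b \<in> B"
        then have "\<bar>inner w b\<bar> \<le> norm w" using Cauchy_Schwarz_ineq2[of w b] B(2) by simp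
        then show "norm (inner w b *\<^sub>R ?D x b) \<le> norm w * norm (?D x b)"
          by (simp add: mult_right_mono)
      qed
      finally show ?thesis by (simp add: M_def sum_distrib_left mult.commute)
    qed
    then have "onorm (?D x) \<le> M x"
      by (intro onorm_bound) (auto simp: M_def sum_nonneg)
    then show "onorm (?D x) \<le> M x0 + 1" using Mb[OF x] by simp
  qed
  then have "(M x0 + 1)-lipschitz_on (cball x0 r) f"
    using M0 by (auto simp: lipschitz_on_def dist_norm)
  then show thesis using that[of r "M x0 + 1"] r M0 by simp
qed

section \<open>Local existence and uniqueness for autonomous differential equations\<close>

text \<open>Derivatives are taken within the closed interval because an antiderivative on it offers
  no more at the endpoints.\<close>

lemma norm_le_by_vector_derivative:
  fixes h :: "real \<Rightarrow> 'a::real_normed_vector"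
  assumes "\<And>t. t \<in> {-d..d} \<Longrightarrow> (h has_vector_derivative h' t) (at t within {-d..d})"
    and "\<And>t. t \<in> {-d..d} \<Longrightarrow> norm (h' t) \<le> K" and "h 0 = 0" and t: "t \<in> {-d..d}"
  shows "norm (h t) \<le> K * \<bar>t\<bar>"
proof -
  have "norm (h t - h 0) \<le> K * norm (t - 0)"
  proof (rule differentiable_bound[where f' = "\<lambda>t v. v *\<^sub>R h' t" and S = "{-d..d}"])
    fix s assume s: "s \<in> {-d..d}"
    show "(h has_derivative (\<lambda>v. v *\<^sub>R h' s)) (at s within {-d..d})"
      using assms(1)[OF s] by (simp add: has_vector_derivative_def)
    show "onorm (\<lambda>v. v *\<^sub>R h' s) \<le> K"
      using assms(2)[OF s] by (intro onorm_bound order_trans[OF norm_ge_zero])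
        (simp_all add: mult.commute[of K] mult_left_mono)
  qed (use t in auto)
  then show ?thesis using assms(3) by simp
qed

text \<open>On an interval this short the maximal distance between the two solutions is at most half
  of itself, hence 0.\<close>

lemma ode_local_uniqueness:
  fixes f :: "'a::real_normed_vector \<Rightarrow> 'a"
  assumes "L-lipschitz_on K f" "d * L \<le> 1 / 2"
    and u: "\<And>t. t \<in> {-d<..<d} \<Longrightarrow> u t \<in> K \<and> (u has_vector_derivative f (u t)) (at t)"
    and v: "\<And>t. t \<in> {-d<..<d} \<Longrightarrow> v t \<in> K \<and> (v has_vector_derivative f (v t)) (at t)"
    and "u 0 = v 0" and t: "t \<in> {-d<..<d}"
  shows "u t = v t"
proof -
  \<comment> \<open>Nothing is assumed at the times \<open>-d\<close> and \<open>d\<close>; the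
    compact interval up to \<open>t\<close> lies strictly inside and provides a maximum.\<close>
  define c where "c = \<bar>t\<bar>"
  have c: "{-c..c} \<subseteq> {-d<..<d}" "0 \<le> c" "c \<le> d" using t by (auto simp: c_def)
  have L: "0 \<le> L" using assms(1) by (rule lipschitz_on_nonneg)
  let ?h = "\<lambda>s. u s - v s"
  have h: "(?h has_vector_derivative f (u s) - f (v s)) (at s)" if "s \<in> {-c..c}" for s
    using u[of s] v[of s] that c(1) by (auto intro!: has_vector_derivative_diff)
  then have "continuous_on {-c..c} ?h"
    by (meson continuous_at_imp_continuous_on has_vector_derivative_continuous)
  then have "continuous_on {-c..c} (\<lambda>s. norm (?h s))" by (rule continuous_on_norm)
  then obtain s where s: "s \<in> {-c..c}" and max: "\<And>r. r \<in> {-c..c} \<Longrightarrow> norm (?h r) \<le> norm (?h s)"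
    using continuous_attains_sup[of "{-c..c}" "\<lambda>s. norm (?h s)"] c(2) by auto
  have "norm (?h s) \<le> (L * norm (?h s)) * \<bar>s\<bar>"
  proof (rule norm_le_by_vector_derivative[OF _ _ _ s])
    fix r assume r: "r \<in> {-c..c}"
    show "(?h has_vector_derivative f (u r) - f (v r)) (at r within {-c..c})"
      using h[OF r] by (rule has_vector_derivative_at_within)
    have "u r \<in> K" "v r \<in> K" using u v r c(1) by auto
    then have "norm (f (u r) - f (v r)) \<le> L * norm (?h r)"
      using lipschitz_onD[OF assms(1)] by (simp add: dist_norm)
    also have "\<dots> \<le> L * norm (?h s)" using max[OF r] L by (rule mult_left_mono)
    finally show "norm (f (u r) - f (v r)) \<le> L * norm (?h s)" .
  qed (use assms(5) in simp)
  also have "\<dots> \<le> (L * norm (?h s)) * d"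
    using s c L by (intro mult_left_mono) auto
  also have "\<dots> = (d * L) * norm (?h s)" by simp
  also have "\<dots> \<le> 1 / 2 * norm (?h s)" using assms(2) by (intro mult_right_mono) auto
  finally have "norm (?h s) = 0" using norm_ge_zero[of "?h s"] by linarith
  moreover have "t \<in> {-c..c}" unfolding c_def by auto
  ultimately have "norm (?h t) \<le> 0" using max by metis
  then show ?thesis by simp
qed

text \<open>The integral over \<open>{0..t}\<close> would vanish for \<open>t < 0\<close>, so
  integration starts at \<open>-d\<close> and the value at 0 is subtracted.\<close>

lemma antiderivative_vanishing_at_0:
  fixes g :: "real \<Rightarrow> 'a::banach"
  assumes "continuous_on {-d..d} g"
  shows "\<exists>P. P 0 = 0 \<and> (\<forall>t\<in>{-d..d}. (P has_vector_derivative g t) (at t within {-d..d}))"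
proof (intro exI[of _ "\<lambda>t. integral {-d..t} g - integral {-d..0} g"] conjI ballI)
  fix t assume t: "t \<in> {-d..d}"
  show "((\<lambda>t. integral {-d..t} g - integral {-d..0} g) has_vector_derivative g t)
      (at t within {-d..d})"
    using has_vector_derivative_diff[OF integral_has_vector_derivative[OF assms(1) t]
        has_vector_derivative_const] by simp
qed simp

text \<open>Picard iteration. The iterates are functions on the whole real line, constant outside the
  interval \<open>{-d..d}\<close>, so as to live in the complete space of bounded continuous functions.\<close>

lemma ode_local_existence:
  fixes f :: "'a::banach \<Rightarrow> 'a"
  assumes r: "0 < r" and L: "0 < L" and lip: "L-lipschitz_on (cball x0 r) f"
  obtains d u where "0 < d" "u 0 = x0"
    and "\<And>t. t \<in> {-d<..<d} \<Longrightarrow> (u has_vector_derivative f (u t)) (at t)"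
proof -
  define M where "M = norm (f x0) + L * r"
  have M: "norm (f x) \<le> M" if "x \<in> cball x0 r" for x
  proof -
    have "norm (f x - f x0) \<le> L * dist x x0"
      using lipschitz_onD[OF lip that, of x0] r by (simp add: dist_norm)
    also have "\<dots> \<le> L * r" using that L by (intro mult_left_mono) (auto simp: dist_commute)
    finally have "norm (f x - f x0) \<le> L * r" .
    then show ?thesis using norm_triangle_sub[of "f x" "f x0"] by (simp add: M_def)
  qed
  have M0: "0 \<le> M" using r L by (simp add: M_def)
  \<comment> \<open>\<open>M\<close> bounds the norm of \<open>f\<close> on the ball. The first term
    makes the Picard operator contract by 1/2, the second keeps its values in the ball.\<close>
  define d where "d = min (1 / (2 * L)) (r / (M + 1))"
  have d: "0 < d" using r L M0 by (simp add: d_def)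
  have dL: "d * L \<le> 1 / 2"
  proof -
    have "d \<le> 1 / (2 * L)" by (simp add: d_def)
    then show ?thesis using L by (simp add: field_simps)
  qed
  have dM: "M * d \<le> r"
  proof -
    have "d \<le> r / (M + 1)" by (simp add: d_def)
    then have "(M + 1) * d \<le> r" using M0 by (simp add: field_simps)
    then show ?thesis using d by (simp add: algebra_simps)
  qed
  define cl where "cl t = max (-d) (min d t)" for t :: real
  have cl: "cl t \<in> {-d..d}" "\<bar>cl t\<bar> \<le> d" for t using d by (auto simp: cl_def)
  have cl_cont: "continuous_on UNIV cl" unfolding cl_def by (intro continuous_intros)
  define S where "S = PiC (UNIV :: real set) (\<lambda>_. cball x0 r)"
  have S: "w \<in> S \<longleftrightarrow> (\<forall>t. w t \<in> cball x0 r)" for w by (auto simp: S_def mem_PiC_iff)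
  have "\<exists>P. P 0 = 0 \<and> (\<forall>t\<in>{-d..d}. (P has_vector_derivative f (w t)) (at t within {-d..d}))"
    if "w \<in> S" for w
  proof -
    have "continuous_on {-d..d} (\<lambda>t. f (w t))"
      by (rule continuous_on_compose2[OF lipschitz_on_continuous_on[OF lip]
            continuous_on_apply_bcontfun]) (use that in \<open>auto simp: S simp del: mem_cball\<close>)
    then show ?thesis by (rule antiderivative_vanishing_at_0)
  qed
  then obtain P where P0: "\<And>w. w \<in> S \<Longrightarrow> P w 0 = 0"
    and P: "\<And>w t. w \<in> S \<Longrightarrow> t \<in> {-d..d} \<Longrightarrow> (P w has_vector_derivative f (w t)) (at t within {-d..d})"
    by metis
  have P_bound: "norm (P w t) \<le> r" if w: "w \<in> S" and t: "t \<in> {-d..d}" for w t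
  proof -
    have "norm (P w t) \<le> M * \<bar>t\<bar>"
      using w by (intro norm_le_by_vector_derivative[OF P[OF w] _ P0[OF w] t] M) (simp_all add: S)
    also have "\<dots> \<le> M * d" using t M0 by (intro mult_left_mono) auto
    finally show ?thesis using dM by simp
  qed
  define T where "T w = Bcontfun (\<lambda>t. x0 + P w (cl t))" for w
  have T: "T w t = x0 + P w (cl t)" if w: "w \<in> S" for w t
  proof -
    have "continuous_on {-d..d} (P w)"
      using P[OF w] by (meson continuous_on_eq_continuous_within has_vector_derivative_continuous)
    then have "continuous_on UNIV (\<lambda>t. P w (cl t))"
      by (rule continuous_on_compose2[OF _ cl_cont]) (use cl in blast)
    then have "continuous_on UNIV (\<lambda>t. x0 + P w (cl t))"
      by (intro continuous_on_add continuous_on_const)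
    moreover have "norm (x0 + P w (cl t)) \<le> norm x0 + r" for t
      using norm_triangle_ineq[of x0 "P w (cl t)"] P_bound[OF w cl(1)[of t]] by linarith
    ultimately have "(\<lambda>t. x0 + P w (cl t)) \<in> bcontfun" by (rule bcontfun_normI)
    then show ?thesis by (simp add: T_def Bcontfun_inverse)
  qed
  have "\<exists>!w. w \<in> S \<and> T w = w"
  proof (rule Banach_fix)
    show "complete S" unfolding S_def complete_eq_closed by (intro closed_PiC closed_cball)
    show "S \<noteq> {}" using S[of "const_bcontfun x0"] r by auto
    show "T ` S \<subseteq> S" using P_bound cl by (auto simp: S T dist_norm)
    show "dist (T w) (T v) \<le> 1 / 2 * dist w v" if w: "w \<in> S" and v: "v \<in> S" for w v
    proof (rule dist_bound)
      fix t
      have "norm (P w (cl t) - P v (cl t)) \<le> (L * dist w v) * \<bar>cl t\<bar>"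
      proof (rule norm_le_by_vector_derivative[OF _ _ _ cl(1)])
        fix s assume s: "s \<in> {-d..d}"
        show "((\<lambda>s. P w s - P v s) has_vector_derivative f (w s) - f (v s)) (at s within {-d..d})"
          using P[OF w s] P[OF v s] by (rule has_vector_derivative_diff)
        have "norm (f (w s) - f (v s)) \<le> L * dist (w s) (v s)"
          using lipschitz_onD[OF lip, of "w s" "v s"] w v by (simp add: dist_norm S)
        also have "\<dots> \<le> L * dist w v" using L dist_bounded by (intro mult_left_mono) auto
        finally show "norm (f (w s) - f (v s)) \<le> L * dist w v" .
      qed (simp add: P0 w v)
      also have "\<dots> \<le> (L * dist w v) * d" using L cl by (intro mult_left_mono) auto
      also have "\<dots> = (d * L) * dist w v" by simp
      also have "\<dots> \<le> 1 / 2 * dist w v" using dL by (intro mult_right_mono) auto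
      finally show "dist (T w t) (T v t) \<le> 1 / 2 * dist w v"
        using w v by (simp add: T dist_norm)
    qed
  qed auto
  then obtain w where w: "w \<in> S" "T w = w" by blast
  have wP: "w t = x0 + P w t" if "t \<in> {-d..d}" for t
    using T[OF w(1), of t] w(2) that by (simp add: cl_def)
  show thesis
  proof
    show "0 < d" by (rule d)
    show "w 0 = x0" using wP[of 0] d P0[OF w(1)] by simp
    fix t assume t: "t \<in> {-d<..<d}"
    then have "((\<lambda>s. x0 + P w s) has_vector_derivative f (w t)) (at t within {-d..d})"
      using has_vector_derivative_add[OF has_vector_derivative_const P[OF w(1)], of t x0] by auto
    moreover have "at t within {-d..d} = at t" using t by (intro at_within_interior) simp
    ultimately have "((\<lambda>s. x0 + P w s) has_vector_derivative f (w t)) (at t)" by simp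
    then show "(w has_vector_derivative f (w t)) (at t)"
      by (rule has_vector_derivative_transform_within_open[where S = "{-d<..<d}"])
        (use t wP in auto)
  qed
qed

text \<open>Bootstrapping: once \<open>u\<close> has \<open>k\<close> continuous derivatives, so
  does its derivative \<open>f (u t)\<close>, and \<open>u\<close> gains one.\<close>

lemma ode_solution_smooth:
  fixes u :: "real \<Rightarrow> 'a::euclidean_model"
  assumes "open T" "smooth_on S f"
    and u: "\<And>t. t \<in> T \<Longrightarrow> u t \<in> S" "\<And>t. t \<in> T \<Longrightarrow> (u has_vector_derivative f (u t)) (at t)"
  shows "smooth_on T u"
  unfolding smooth_on_def
proof
  fix k show "C_on k T u"
  proof (induction k)
    case 0
    show ?case
      using u(2) by (auto intro!: continuous_at_imp_continuous_on has_vector_derivative_continuous)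
  next
    case (Suc k)
    have "C_on k T (\<lambda>t. f (u t))"
      using assms(2) u(1) by (intro C_on_compose[OF assms(1) _ Suc, of S]) (auto simp: smooth_on_def)
    then have "C_on k T (\<lambda>t. v *\<^sub>R f (u t))" for v
      by (intro C_on_scaleR[OF assms(1)] C_on_const[OF assms(1)])
    then show ?case
      using u(2) by (intro C_on_SucI[OF assms(1)]) (auto simp: has_vector_derivative_def)
  qed
qed


section \<open>Charts, smooth maps and velocities\<close>

lemma chart_inv_left: "is_chart c \<Longrightarrow> p \<in> fst c \<Longrightarrow> chart_inv c (snd c p) = p"
  by (simp add: is_chart_def homeomorphism_def)

lemma chart_inv_right: "x \<in> snd c ` fst c \<Longrightarrow> snd c (chart_inv c x) = x"
  by (simp add: chart_inv_def f_inv_into_f)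

lemma chart_inv_in: "x \<in> snd c ` fst c \<Longrightarrow> chart_inv c x \<in> fst c"
  by (simp add: chart_inv_def inv_into_into)

lemma chart_image_Int:
  "is_chart c \<Longrightarrow> snd c ` (fst c \<inter> U) = {x \<in> snd c ` fst c. chart_inv c x \<in> U}"
  by (auto simp: chart_inv_left)

lemma open_chart_image:
  assumes "is_chart c" "open U" shows "open (snd c ` (fst c \<inter> U))"
proof -
  have "open (snd c ` fst c \<inter> chart_inv c -` U)"
    using assms by (intro continuous_open_preimage) (auto simp: is_chart_def homeomorphism_def)
  then show ?thesis
    unfolding chart_image_Int[OF assms(1)] by (simp add: Int_def vimage_def)
qed

text \<open>\<open>chart_inv\<close> is an \<open>inv_into\<close> and has no meaning off the image;
  on the product of the images injectivity forces it to split.\<close>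

lemma chart_inv_prod:
  assumes "is_chart c" "is_chart d" "x \<in> snd c ` fst c" "y \<in> snd d ` fst d"
  shows "chart_inv (fst c \<times> fst d, map_prod (snd c) (snd d)) (x, y) = (chart_inv c x, chart_inv d y)"
proof -
  have "inj_on (snd c) (fst c)" "inj_on (snd d) (fst d)"
    using assms(1,2) by (metis chart_inv_left inj_on_inverseI)+
  then have "inj_on (map_prod (snd c) (snd d)) (fst c \<times> fst d)"
    by (rule map_prod_inj_on)
  then have "inv_into (fst c \<times> fst d) (map_prod (snd c) (snd d))
      (map_prod (snd c) (snd d) (chart_inv c x, chart_inv d y)) = (chart_inv c x, chart_inv d y)"
    by (rule inv_into_f_f) (simp add: chart_inv_in assms)
  then show ?thesis by (simp add: chart_inv_def[of "(_, _)"] chart_inv_right assms)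
qed

lemma charts_at_is_chart: "smooth_manifold A \<Longrightarrow> c \<in> charts_at A p \<Longrightarrow> is_chart c"
  by (simp add: smooth_manifold_def charts_at_def)

lemma charts_at_nonempty:
  assumes "smooth_manifold A" shows "\<exists>c. c \<in> charts_at A p"
proof -
  have "p \<in> (\<Union>c\<in>A. fst c)" using assms by (simp add: smooth_manifold_def)
  then show ?thesis unfolding charts_at_def by blast
qed

text \<open>Freezing \<open>p\<close> composes the coordinate form of \<open>h\<close> with
  \<open>x \<mapsto> (snd a p, x)\<close>, for any chart \<open>a\<close> around \<open>p\<close>.
  Applied to left translations of the group and to the orbit map of a point.\<close>

lemma smooth_map_section:
  assumes A: "smooth_manifold A" and B: "smooth_manifold B" and C: "smooth_manifold C"
    and h: "smooth_map (prod_atlas A B) C h"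
  shows "smooth_map B C (\<lambda>y. h (p, y))"
  unfolding smooth_map_def
proof (intro conjI ballI)
  show cont: "continuous_on UNIV (\<lambda>y. h (p, y))"
    using h unfolding smooth_map_def
    by (intro continuous_on_compose2[of UNIV h UNIV "Pair p"]) (auto intro!: continuous_intros)
  fix c d assume c: "c \<in> B" and d: "d \<in> C"
  obtain a where a: "a \<in> charts_at A p" using charts_at_nonempty[OF A] by blast
  let ?p = "(fst a \<times> fst c, map_prod (snd a) (snd c))"
  let ?S = "snd c ` (fst c \<inter> (\<lambda>y. h (p, y)) -` fst d)"
  let ?T = "snd ?p ` (fst ?p \<inter> h -` fst d)"
  have ch: "is_chart c" "is_chart a" using B c a A by (auto simp: smooth_manifold_def charts_at_def)
  have "?p \<in> prod_atlas A B" using a c unfolding prod_atlas_def charts_at_def by blast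
  then have sm: "smooth_on ?T (snd d \<circ> h \<circ> chart_inv ?p)" using h d unfolding smooth_map_def by blast
  show "smooth_on ?S (snd d \<circ> (\<lambda>y. h (p, y)) \<circ> chart_inv c)"
  proof -
    have "open (fst d)" using C d by (simp add: smooth_manifold_def is_chart_def)
    then have "open ((\<lambda>y. h (p, y)) -` fst d)" using cont by (simp add: continuous_on_open_vimage)
    then have S: "open ?S" by (rule open_chart_image[OF ch(1)])
    have "(\<lambda>x. (snd a p, x)) ` ?S \<subseteq> ?T"
      using a by (force simp: charts_at_def)
    moreover have "C_on k ?T (snd d \<circ> h \<circ> chart_inv ?p)" for k
      using sm unfolding smooth_on_def by blast
    ultimately have "C_on k ?S (\<lambda>x. (snd d \<circ> h \<circ> chart_inv ?p) (snd a p, x))" for k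
      by (rule C_on_compose[OF S _ C_on_Pair[OF S C_on_const[OF S] C_on_ident[OF S]]])
    then have "smooth_on ?S (\<lambda>x. (snd d \<circ> h \<circ> chart_inv ?p) (snd a p, x))"
      by (simp add: smooth_on_def)
    then show ?thesis
    proof (rule smooth_on_cong[OF S, rotated])
      fix x assume "x \<in> ?S"
      then have "x \<in> snd c ` fst c" by blast
      then show "(snd d \<circ> h \<circ> chart_inv ?p) (snd a p, x) = (snd d \<circ> (\<lambda>y. h (p, y)) \<circ> chart_inv c) x"
        using a by (simp add: chart_inv_prod ch chart_inv_left charts_at_def)
    qed
  qed
qed

lemma smooth_curve_iff:
  fixes \<gamma> :: "real \<Rightarrow> 'm::topological_space"
  shows "smooth_map vector_atlas A \<gamma> \<longleftrightarrow>
    continuous_on UNIV \<gamma> \<and> (\<forall>d\<in>A. smooth_on (\<gamma> -` fst d) (snd d \<circ> \<gamma>))"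
proof -
  have "chart_inv (UNIV, id :: real \<Rightarrow> real) = id" by (simp add: chart_inv_def inv_id)
  then show ?thesis by (simp add: smooth_map_def vector_atlas_def)
qed

lemma transition_has_derivative:
  assumes "smooth_manifold A" "c \<in> charts_at A p" "d \<in> charts_at A p"
  shows "(snd d \<circ> chart_inv c has_derivative frechet_derivative (snd d \<circ> chart_inv c) (at (snd c p)))
    (at (snd c p))"
proof (rule C_on_has_derivative)
  have "smooth_on (snd c ` (fst c \<inter> fst d)) (snd d \<circ> chart_inv c)"
    using assms by (auto simp: smooth_manifold_def charts_at_def)
  then show "C_on (Suc 0) (snd c ` (fst c \<inter> fst d)) (snd d \<circ> chart_inv c)"
    unfolding smooth_on_def by blast
  show "snd c p \<in> snd c ` (fst c \<inter> fst d)" using assms by (auto simp: charts_at_def)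
qed

lemma tangent_space_transition:
  "v \<in> tangent_space A p \<Longrightarrow> c \<in> charts_at A p \<Longrightarrow> d \<in> charts_at A p \<Longrightarrow>
    v d = frechet_derivative (snd d \<circ> chart_inv c) (at (snd c p)) (v c)"
  unfolding tangent_space_def by blast

lemma tangent_space_outside: "v \<in> tangent_space A p \<Longrightarrow> c \<notin> charts_at A p \<Longrightarrow> v c = 0"
  unfolding tangent_space_def by blast

lemma scale_tangent_in_tangent_space:
  assumes "smooth_manifold A" "v \<in> tangent_space A p"
  shows "scale_tangent t v \<in> tangent_space A p"
proof -
  have "t *\<^sub>R v d = frechet_derivative (snd d \<circ> chart_inv c) (at (snd c p)) (t *\<^sub>R v c)"
    if "c \<in> charts_at A p" "d \<in> charts_at A p" for c d
  proof -
    interpret bounded_linear "frechet_derivative (snd d \<circ> chart_inv c) (at (snd c p))"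
      using transition_has_derivative[OF assms(1) that] by (rule has_derivative_bounded_linear)
    show ?thesis by (simp add: scaleR tangent_space_transition[OF assms(2) that])
  qed
  moreover have "t *\<^sub>R v c = 0" if "c \<notin> charts_at A p" for c
    using tangent_space_outside[OF assms(2) that] by simp
  ultimately show ?thesis
    unfolding tangent_space_def scale_tangent_def by (intro CollectI conjI allI impI ballI)
qed

text \<open>In charts around \<open>p\<close> the components are derivatives, hence unique; the
  convention of 0 in all other charts determines the rest of the family.\<close>

lemma has_velocity_unique:
  assumes "has_velocity A p \<gamma> v" "has_velocity A p \<gamma> w" shows "v = w"
proof
  fix c show "v c = w c"
  proof (cases "c \<in> charts_at A p")
    case True
    then show ?thesis using assms unfolding has_velocity_def by (blast intro: vector_derivative_unique_at)
  next
    case False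
    have "v \<in> tangent_space A p" "w \<in> tangent_space A p"
      using assms unfolding has_velocity_def by blast+
    then show ?thesis using tangent_space_outside[OF _ False] by metis
  qed
qed

lemma velocity_eq: "has_velocity A p \<gamma> v \<Longrightarrow> velocity A p \<gamma> = v"
  unfolding velocity_def by (blast intro: has_velocity_unique)

text \<open>One chart suffices: the components of a tangent vector transform by the derivative of
  the transition map, just as velocities do by the chain rule.\<close>

lemma has_velocityI_chart:
  assumes A: "smooth_manifold A" and c: "c \<in> charts_at A p" and v: "v \<in> tangent_space A p"
    and \<gamma>: "\<gamma> 0 = p" "isCont \<gamma> 0" "((\<lambda>s. snd c (\<gamma> s)) has_vector_derivative v c) (at 0)"
  shows "has_velocity A p \<gamma> v"
  unfolding has_velocity_def
proof (intro conjI ballI \<gamma>(1,2) v)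
  fix d assume d: "d \<in> charts_at A p"
  let ?D = "frechet_derivative (snd d \<circ> chart_inv c) (at (snd c p))"
  have ch: "is_chart c" using A c by (rule charts_at_is_chart)
  have tr: "(snd d \<circ> chart_inv c has_derivative ?D) (at (snd c (\<gamma> 0)))"
    using transition_has_derivative[OF A c d] by (simp only: \<gamma>(1))
  interpret bounded_linear ?D using tr by (rule has_derivative_bounded_linear)
  have "((\<lambda>s. snd c (\<gamma> s)) has_derivative (\<lambda>h. h *\<^sub>R v c)) (at 0)"
    using \<gamma>(3) by (simp only: has_vector_derivative_def)
  from has_derivative_compose[OF this tr]
  have "((\<lambda>s. (snd d \<circ> chart_inv c) (snd c (\<gamma> s))) has_vector_derivative ?D (v c)) (at 0)"
    by (simp only: has_vector_derivative_def scaleR)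
  then have deriv: "((\<lambda>s. (snd d \<circ> chart_inv c) (snd c (\<gamma> s))) has_vector_derivative v d) (at 0)"
    by (simp only: tangent_space_transition[OF v c d])
  \<comment> \<open>The inverse chart undoes \<open>snd c\<close> only on the chart domain;
    continuity keeps the curve there near time 0.\<close>
  have "open (fst c)" "\<gamma> 0 \<in> fst c"
    using ch c \<gamma>(1) by (simp_all add: is_chart_def charts_at_def)
  then obtain S where S: "open S" "0 \<in> S" "\<And>s. s \<in> S \<Longrightarrow> \<gamma> s \<in> fst c"
    using \<gamma>(2)[unfolded continuous_at_open, rule_format, of "fst c"] by blast
  show "((\<lambda>s. snd d (\<gamma> s)) has_vector_derivative v d) (at 0)"
    by (rule has_vector_derivative_transform_within_open[OF deriv S(1,2)])
      (simp add: chart_inv_left ch S)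
qed

text \<open>Differentiability at time 0 alone is assumed and preserved, so a curve can be pushed
  through several smooth maps: below, by the orbit map into the manifold and then by a component of
  \<open>Y\<close> into the model space.\<close>

lemma differentiable_smooth_map_curve:
  fixes \<gamma> :: "real \<Rightarrow> 'm::t2_space"
  assumes c: "is_chart c" "c \<in> A" "\<gamma> 0 \<in> fst c" and \<gamma>: "isCont \<gamma> 0"
    and diff: "(\<lambda>t. snd c (\<gamma> t)) differentiable (at 0)"
    and f: "smooth_map A B f" and d: "d \<in> B" "f (\<gamma> 0) \<in> fst d"
  shows "(\<lambda>t. snd d (f (\<gamma> t))) differentiable (at 0)"
proof -
  let ?K = "snd d \<circ> f \<circ> chart_inv c" and ?S = "snd c ` (fst c \<inter> f -` fst d)"
  have "smooth_on ?S ?K" using f c(2) d(1) unfolding smooth_map_def by blast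
  then have "C_on (Suc 0) ?S ?K" unfolding smooth_on_def by blast
  moreover have "snd c (\<gamma> 0) \<in> ?S" using c(3) d(2) by blast
  ultimately have K: "?K differentiable (at (snd c (\<gamma> 0)))" unfolding C_on.simps by blast
  have "open (fst c)" using c(1) by (simp add: is_chart_def)
  then obtain S where S: "open S" "0 \<in> S" "\<And>s. s \<in> S \<Longrightarrow> \<gamma> s \<in> fst c"
    using \<gamma>[unfolded continuous_at_open, rule_format, of "fst c"] c(3) by blast
  obtain D where "(?K \<circ> (\<lambda>t. snd c (\<gamma> t)) has_derivative D) (at 0)"
    using differentiable_chain_at[OF diff K] unfolding differentiable_def by blast
  then have "((\<lambda>t. snd d (f (\<gamma> t))) has_derivative D) (at 0)"
    by (rule has_derivative_transform_within_open[OF _ S(1,2)]) (simp add: chart_inv_left c(1) S(3))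
  then show ?thesis unfolding differentiable_def by blast
qed


section \<open>Extension of local homomorphisms from the real line\<close>

lemma ex_abs_less_power_2_mult:
  fixes \<eta> :: real assumes "0 < \<eta>" shows "\<exists>k. \<bar>t\<bar> < 2 ^ k * \<eta>"
proof -
  obtain k where "\<bar>t\<bar> / \<eta> < 2 ^ k" using real_arch_pow[of 2 "\<bar>t\<bar> / \<eta>"] by auto
  then have "\<bar>t\<bar> < 2 ^ k * \<eta>" using assms by (simp add: field_simps)
  then show ?thesis ..
qed

text \<open>The value at \<open>t\<close> is the square of the value at \<open>t / 2\<close>, so the
  range of agreement doubles at each step.\<close>

lemma eq_of_eq_near_0:
  fixes \<gamma> \<gamma>' :: "real \<Rightarrow> 'g"
  assumes hom: "\<And>s t. \<gamma> (s + t) = mul (\<gamma> s) (\<gamma> t)" "\<And>s t. \<gamma>' (s + t) = mul (\<gamma>' s) (\<gamma>' t)"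
    and \<eta>: "0 < \<eta>" "\<And>t. \<bar>t\<bar> < \<eta> \<Longrightarrow> \<gamma> t = \<gamma>' t"
  shows "\<gamma> = \<gamma>'"
proof
  have *: "\<bar>t\<bar> < 2 ^ k * \<eta> \<Longrightarrow> \<gamma> t = \<gamma>' t" for k t
  proof (induction k arbitrary: t)
    case 0
    then show ?case using \<eta> by simp
  next
    case (Suc k)
    then have "\<gamma> (t / 2) = \<gamma>' (t / 2)" by (intro Suc.IH) (simp add: field_simps)
    then show ?case using hom(1)[of "t / 2" "t / 2"] hom(2)[of "t / 2" "t / 2"] by simp
  qed
  fix t show "\<gamma> t = \<gamma>' t"
    using ex_abs_less_power_2_mult[OF \<eta>(1), of t] * by metis
qed

text \<open>A local homomorphism on \<open>{-\<eta><..<\<eta>}\<close> is doubled to \<open>t \<mapsto> \<gamma>\<^sub>0 (t/2) \<gamma>\<^sub>0 (t/2)\<close>, a local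
  homomorphism on \<open>{-2\<eta><..<2\<eta>}\<close> that agrees with it near 0.\<close>

lemma extend_local_homomorphism:
  fixes \<gamma>0 :: "real \<Rightarrow> 'g"
  assumes assoc: "\<And>a b c. mul (mul a b) c = mul a (mul b c)"
    and \<eta>: "0 < \<eta>"
    and hom: "\<And>s t. \<bar>s\<bar> < \<eta> \<Longrightarrow> \<bar>t\<bar> < \<eta> \<Longrightarrow> \<gamma>0 (s + t) = mul (\<gamma>0 s) (\<gamma>0 t)"
  obtains \<gamma> where "\<And>s t. \<gamma> (s + t) = mul (\<gamma> s) (\<gamma> t)" "\<And>t. \<bar>t\<bar> < \<eta> \<Longrightarrow> \<gamma> t = \<gamma>0 t"
proof -
  define G where "G k = ((\<lambda>f t. mul (f (t / 2)) (f (t / 2))) ^^ k) \<gamma>0" for k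
  have G0: "G 0 = \<gamma>0" and GS: "\<And>k t. G (Suc k) t = mul (G k (t / 2)) (G k (t / 2))"
    by (simp_all add: G_def)
  have Ghom: "\<bar>s\<bar> < 2 ^ k * \<eta> \<Longrightarrow> \<bar>t\<bar> < 2 ^ k * \<eta> \<Longrightarrow> G k (s + t) = mul (G k s) (G k t)" for k s t
  proof (induction k arbitrary: s t)
    case 0
    then show ?case by (simp add: G0 hom)
  next
    case (Suc k)
    let ?a = "G k (s / 2)" and ?b = "G k (t / 2)"
    have st: "\<bar>s / 2\<bar> < 2 ^ k * \<eta>" "\<bar>t / 2\<bar> < 2 ^ k * \<eta>" using Suc.prems by (simp_all add: field_simps)
    have "G k (s / 2 + t / 2) = mul ?a ?b" "G k (t / 2 + s / 2) = mul ?b ?a"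
      using Suc.IH st by blast+
    \<comment> \<open>The group need not be commutative, but \<open>?a\<close> and \<open>?b\<close>
      commute because \<open>s + t = t + s\<close>. This is what lets the square of their product be
      regrouped.\<close>
    then have ab: "G k ((s + t) / 2) = mul ?a ?b" "mul ?b ?a = mul ?a ?b"
      by (simp_all add: add_divide_distrib add.commute)
    have "mul (mul ?a ?b) (mul ?a ?b) = mul ?a (mul (mul ?b ?a) ?b)" by (simp only: assoc)
    also have "\<dots> = mul (mul ?a ?a) (mul ?b ?b)" by (simp only: assoc ab(2))
    finally show ?case by (simp only: GS ab(1))
  qed
  have Gmono: "G n t = G k t" if "k \<le> n" "\<bar>t\<bar> < 2 ^ k * \<eta>" for k n t
    using that(1)
  proof (induction n rule: dec_induct)
    case (step n)
    have "(2::real) ^ k \<le> 2 ^ n" using step.hyps by simp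
    then have "2 ^ k * \<eta> \<le> 2 ^ n * \<eta>" using \<eta> by simp
    then have "\<bar>t / 2\<bar> < 2 ^ n * \<eta>" using that(2) by linarith
    then have "G n (t / 2 + t / 2) = G (Suc n) t" unfolding GS by (intro Ghom)
    then show ?case using step.IH by simp
  qed simp
  \<comment> \<open>Stage \<open>K t\<close> is one whose interval contains \<open>t\<close>. By
    \<open>Gmono\<close> all later stages give the same value, so finitely many times can be treated
    at one common stage.\<close>
  obtain K where K: "\<And>t. \<bar>t\<bar> < 2 ^ K t * \<eta>" using ex_abs_less_power_2_mult[OF \<eta>] by metis
  define \<gamma> where "\<gamma> t = G (K t) t" for t
  have \<gamma>: "\<gamma> t = G n t" if "K t \<le> n" for n t
    unfolding \<gamma>_def using Gmono[OF that K] by simp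
  show thesis
  proof
    fix s t
    define n where "n = max (K (s + t)) (max (K s) (K t))"
    have n: "K s \<le> n" "K t \<le> n" "K (s + t) \<le> n" by (simp_all add: n_def)
    have "\<bar>r\<bar> < 2 ^ n * \<eta>" if "K r \<le> n" for r
    proof -
      have "(2::real) ^ K r \<le> 2 ^ n" using that by simp
      then have "2 ^ K r * \<eta> \<le> 2 ^ n * \<eta>" using \<eta> by simp
      then show ?thesis using K[of r] by linarith
    qed
    then show "\<gamma> (s + t) = mul (\<gamma> s) (\<gamma> t)"
      unfolding \<gamma>[OF n(1)] \<gamma>[OF n(2)] \<gamma>[OF n(3)] using n by (intro Ghom)
  next
    fix t assume "\<bar>t\<bar> < \<eta>"
    then have "G (K t) t = G 0 t" by (intro Gmono) simp_all
    then show "\<gamma> t = \<gamma>0 t" by (simp add: \<gamma>_def G0)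
  qed
qed


section \<open>One-parameter subgroups of a Lie group\<close>

text \<open>In a chart \<open>c\<close> around the unit the product becomes the map \<open>F\<close>, defined on \<open>W\<close>, and \<open>vf z\<close> is
  the left invariant vector field with value \<open>z\<close> at the unit.\<close>

locale lie_group_chart =
  fixes AG :: "('g::{t2_space,second_countable_topology}, 'c::euclidean_model) chart set"
    and mul :: "'g \<Rightarrow> 'g \<Rightarrow> 'g" and e :: 'g and ginv :: "'g \<Rightarrow> 'g" and c :: "('g, 'c) chart"
  assumes lie: "lie_group AG mul e ginv" and c: "c \<in> charts_at AG e"
begin

abbreviation \<phi> where "\<phi> \<equiv> snd c"
abbreviation \<psi> where "\<psi> \<equiv> chart_inv c"
abbreviation V where "V \<equiv> snd c ` fst c"
abbreviation x0 where "x0 \<equiv> snd c e"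

definition W where "W = {p \<in> V \<times> V. mul (\<psi> (fst p)) (\<psi> (snd p)) \<in> fst c}"

definition F where "F p = \<phi> (mul (\<psi> (fst p)) (\<psi> (snd p)))"

definition vf where "vf z x = frechet_derivative F (at (x, x0)) (0, z)"

lemma F_Pair: "F (x, y) = \<phi> (mul (\<psi> x) (\<psi> y))"
  by (simp add: F_def)

lemma manifold: "smooth_manifold AG"
  using lie by (simp add: lie_group_def)

lemma assoc: "mul (mul a b) d = mul a (mul b d)"
  and unit: "mul e a = a" "mul a e = a"
proof -
  interpret G: group mul e ginv using lie by (simp add: lie_group_def)
  show "mul (mul a b) d = mul a (mul b d)" "mul e a = a" "mul a e = a"
    by (fact G.assoc G.left_neutral G.right_neutral)+
qed

lemma continuous_mul: "continuous_on UNIV (\<lambda>(a, b). mul a b)"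
  using lie by (simp add: lie_group_def smooth_map_def)

lemma chart: "is_chart c" "c \<in> AG" "e \<in> fst c" "open (fst c)" "open V" "x0 \<in> V"
    "continuous_on V \<psi>" "continuous_on (fst c) \<phi>"
proof -
  show "is_chart c" using charts_at_is_chart[OF manifold c] .
  then show "open (fst c)" "open V" "continuous_on V \<psi>" "continuous_on (fst c) \<phi>"
    by (simp_all add: is_chart_def homeomorphism_def)
  show "c \<in> AG" "e \<in> fst c" using c by (simp_all add: charts_at_def)
  then show "x0 \<in> V" by blast
qed

lemmas \<psi>_\<phi> = chart_inv_left[OF chart(1)]
lemmas \<phi>_\<psi> = chart_inv_right[of _ c]
lemmas \<psi>_in = chart_inv_in[of _ c]

lemma \<psi>_x0: "\<psi> x0 = e"
  by (rule \<psi>_\<phi>[OF chart(3)])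

lemma W_iff: "(x, y) \<in> W \<longleftrightarrow> x \<in> V \<and> y \<in> V \<and> mul (\<psi> x) (\<psi> y) \<in> fst c"
  by (auto simp: W_def)

lemma F_in: "p \<in> W \<Longrightarrow> F p \<in> V"
  unfolding W_def F_def by blast

lemma \<psi>_F: "(x, y) \<in> W \<Longrightarrow> \<psi> (F (x, y)) = mul (\<psi> x) (\<psi> y)"
  by (simp add: F_def W_iff \<psi>_\<phi>)

lemma F_\<phi>: "a \<in> fst c \<Longrightarrow> b \<in> fst c \<Longrightarrow> F (\<phi> a, \<phi> b) = \<phi> (mul a b)"
  by (simp add: F_def \<psi>_\<phi>)

lemma W_unit: "x \<in> V \<Longrightarrow> (x, x0) \<in> W" "x \<in> V \<Longrightarrow> (x0, x) \<in> W"
  using chart(6) by (simp_all add: W_iff \<psi>_x0 unit \<psi>_in)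

lemma F_unit: "x \<in> V \<Longrightarrow> F (x, x0) = x" "x \<in> V \<Longrightarrow> F (x0, x) = x"
  by (simp_all add: F_def \<psi>_x0 unit \<phi>_\<psi>)

lemma open_W: "open W"
proof -
  have *: "continuous_on (V \<times> V) (\<lambda>p. (\<psi> (fst p), \<psi> (snd p)))"
    by (intro continuous_on_Pair continuous_on_compose2[OF chart(7)] continuous_on_fst
        continuous_on_snd continuous_on_id) auto
  have "continuous_on (V \<times> V) (\<lambda>p. mul (\<psi> (fst p)) (\<psi> (snd p)))"
    using continuous_on_compose2[OF continuous_mul *] by simp
  then have "open ((V \<times> V) \<inter> (\<lambda>p. mul (\<psi> (fst p)) (\<psi> (snd p))) -` fst c)"
    using chart by (intro continuous_open_preimage open_Times)
  then show ?thesis by (simp add: W_def Int_def vimage_def)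
qed

lemma smooth_F: "smooth_on W F"
proof -
  let ?p = "(fst c \<times> fst c, map_prod \<phi> \<phi>)"
  have "?p \<in> prod_atlas AG AG" using chart(2) unfolding prod_atlas_def by blast
  moreover have "smooth_map (prod_atlas AG AG) AG (\<lambda>(a, b). mul a b)"
    using lie by (simp add: lie_group_def)
  ultimately have sm: "smooth_on (snd ?p ` (fst ?p \<inter> (\<lambda>(a, b). mul a b) -` fst c))
      (\<phi> \<circ> (\<lambda>(a, b). mul a b) \<circ> chart_inv ?p)"
    using chart(2) unfolding smooth_map_def by blast
  have "q \<in> snd ?p ` (fst ?p \<inter> (\<lambda>(a, b). mul a b) -` fst c)" if "q \<in> W" for q
  proof (rule image_eqI[of _ _ "(\<psi> (fst q), \<psi> (snd q))"])
    show "q = snd ?p (\<psi> (fst q), \<psi> (snd q))"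
      using that by (cases q) (simp add: W_iff \<phi>_\<psi>)
    show "(\<psi> (fst q), \<psi> (snd q)) \<in> fst ?p \<inter> (\<lambda>(a, b). mul a b) -` fst c"
      using that by (cases q) (simp add: W_iff \<psi>_in)
  qed
  then have "smooth_on W (\<phi> \<circ> (\<lambda>(a, b). mul a b) \<circ> chart_inv ?p)"
    by (intro smooth_on_subset[OF sm] subsetI)
  then show ?thesis
  proof (rule smooth_on_cong[OF open_W, rotated])
    fix q assume "q \<in> W"
    then show "(\<phi> \<circ> (\<lambda>(a, b). mul a b) \<circ> chart_inv ?p) q = F q"
      by (cases q) (simp add: W_iff F_def chart_inv_prod chart(1))
  qed
qed

lemma F_has_derivative: "p \<in> W \<Longrightarrow> (F has_derivative frechet_derivative F (at p)) (at p)"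
  using C_on_has_derivative[of 0 W F p] smooth_F unfolding smooth_on_def by blast

section \<open>Differentials of left translations and left invariant vector fields in the
  chart\<close>

lemma F_partial:
  assumes "(a, b) \<in> W"
  shows "((\<lambda>y. F (a, y)) has_derivative (\<lambda>w. frechet_derivative F (at (a, b)) (0, w))) (at b)"
proof -
  have "(Pair a has_derivative Pair 0) (at b)"
    by (intro has_derivative_Pair has_derivative_const has_derivative_ident)
  from has_derivative_compose[of "Pair a" "Pair 0" b UNIV F, OF this F_has_derivative[OF assms]]
  show ?thesis .
qed

text \<open>Translation by the unit is the identity near \<open>x0\<close>, so its differential
  there is the identity.\<close>

lemma vf_unit: "vf z x0 = z"
proof -
  have "((\<lambda>y. F (x0, y)) has_derivative (\<lambda>w. w)) (at x0)"
    by (rule has_derivative_transform_within_open[OF has_derivative_ident chart(5,6)])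
      (simp add: F_unit)
  from has_derivative_unique[OF this F_partial[OF W_unit(1)[OF chart(6)]]]
  show ?thesis unfolding vf_def by metis
qed

text \<open>Left invariance: differentiate \<open>F (a, F (b, y)) = F (F (a, b), y)\<close> at \<open>y = x0\<close>.\<close>

lemma vf_left_invariant:
  assumes ab: "(a, b) \<in> W"
  shows "frechet_derivative F (at (a, b)) (0, vf z b) = vf z (F (a, b))"
proof -
  have V: "a \<in> V" "b \<in> V" using ab by (simp_all add: W_iff)
  \<comment> \<open>Only the inner products must lie in the chart domain: \<open>F\<close> is a
    total function, and both outer values are \<open>\<phi>\<close> of the same triple
    product.\<close>
  let ?N = "Pair b -` W"
  have N: "open ?N" by (intro open_vimage open_W continuous_intros)
  have x0: "x0 \<in> ?N" using W_unit(1)[OF V(2)] by simp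
  have "((\<lambda>y. F (a, y)) has_derivative (\<lambda>w. frechet_derivative F (at (a, b)) (0, w)))
      (at (F (b, x0)))"
    using F_partial[OF ab] F_unit(1)[OF V(2)] by simp
  from has_derivative_compose[OF F_partial[OF W_unit(1)[OF V(2)]] this]
  have "((\<lambda>y. F (a, F (b, y))) has_derivative
      (\<lambda>w. frechet_derivative F (at (a, b)) (0, vf w b))) (at x0)"
    by (simp add: vf_def)
  then have "((\<lambda>y. F (F (a, b), y)) has_derivative
      (\<lambda>w. frechet_derivative F (at (a, b)) (0, vf w b))) (at x0)"
  proof (rule has_derivative_transform_within_open[OF _ N x0])
    fix y assume "y \<in> ?N"
    then have "(b, y) \<in> W" by simp
    then show "F (a, F (b, y)) = F (F (a, b), y)"
      by (simp add: F_Pair[of a "F (b, y)"] F_Pair[of "F (a, b)" y] \<psi>_F ab assoc)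
  qed
  from has_derivative_unique[OF this F_partial[OF W_unit(1)[OF F_in[OF ab]]]]
  show ?thesis unfolding vf_def by metis
qed

text \<open>\<open>vf z\<close> is a derivative of \<open>F\<close> in the fixed direction
  \<open>(0, z)\<close>, which \<open>C_on\<close> controls directly, composed with
  \<open>x \<mapsto> (x, x0)\<close>.\<close>

lemma smooth_vf: "smooth_on V (vf z)"
  unfolding smooth_on_def
proof
  fix k
  have "C_on (Suc k) W F" using smooth_F unfolding smooth_on_def by blast
  then have "C_on k W (\<lambda>p. frechet_derivative F (at p) (0, z))" by simp
  then show "C_on k V (vf z)"
    unfolding vf_def using W_unit(1) chart(5)
    by (intro C_on_compose[OF chart(5) _ C_on_Pair[OF chart(5) C_on_ident C_on_const], where T = W]) auto
qed

section \<open>Integral curves through the unit as local homomorphisms\<close>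

lemma F_curve:
  assumes "(a, v t) \<in> W" "(v has_vector_derivative v') (at t)"
  shows "((\<lambda>r. F (a, v r)) has_vector_derivative frechet_derivative F (at (a, v t)) (0, v')) (at t)"
proof -
  interpret bounded_linear "\<lambda>w. frechet_derivative F (at (a, v t)) (0, w)"
    using F_partial[OF assms(1)] by (rule has_derivative_bounded_linear)
  have "(v has_derivative (\<lambda>h. h *\<^sub>R v')) (at t)"
    using assms(2) by (simp only: has_vector_derivative_def)
  from has_derivative_compose[OF this F_partial[OF assms(1)]]
  show ?thesis by (simp only: has_vector_derivative_def scaleR)
qed

lemma vf_locally_lipschitz:
  obtains R L where "0 < R" "0 < L" "L-lipschitz_on (cball x0 R) (vf z)"
proof -
  have "C_on 1 V (vf z)" using smooth_vf unfolding smooth_on_def by blast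
  from C_1_locally_lipschitz[OF chart(5) this chart(6)] that show thesis by metis
qed

lemma local_one_parameter_group:
  obtains \<eta> u where "0 < \<eta>" "u 0 = x0"
    and "\<And>t. \<bar>t\<bar> < \<eta> \<Longrightarrow> u t \<in> V"
    and "\<And>t. \<bar>t\<bar> < \<eta> \<Longrightarrow> (u has_vector_derivative vf z (u t)) (at t)"
    and "\<And>s t. \<bar>s\<bar> < \<eta> \<Longrightarrow> \<bar>t\<bar> < \<eta> \<Longrightarrow> \<psi> (u (s + t)) = mul (\<psi> (u s)) (\<psi> (u t))"
proof -
  obtain R L where R: "0 < R" and L: "0 < L" and lip: "L-lipschitz_on (cball x0 R) (vf z)"
    by (rule vf_locally_lipschitz)
  obtain d u where d: "0 < d" and u0: "u 0 = x0"
    and u': "\<And>t. t \<in> {-d<..<d} \<Longrightarrow> (u has_vector_derivative vf z (u t)) (at t)"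
    by (rule ode_local_existence[OF R L lip]) blast
  have "continuous_on W F" using smooth_F[unfolded smooth_on_def, rule_format, of 0] by simp
  then have "open (W \<inter> F -` ball x0 R)" by (intro continuous_open_preimage open_W open_ball)
  moreover have "(x0, x0) \<in> W \<inter> F -` ball x0 R"
    using W_unit(1)[OF chart(6)] F_unit(1)[OF chart(6)] R by simp
  ultimately obtain A B where AB: "open A" "open B" "x0 \<in> A" "x0 \<in> B" "A \<times> B \<subseteq> W \<inter> F -` ball x0 R"
    by (metis open_prod_elim mem_Sigma_iff)
  \<comment> \<open>Points of \<open>Q\<close> lie in the ball where \<open>vf z\<close> is
    Lipschitz, and so do the coordinates of products of two of them; both curves compared below
    therefore stay in that ball.\<close>
  define Q where "Q = A \<inter> B \<inter> ball x0 R"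
  have Q: "open Q" "x0 \<in> Q" using AB R by (auto simp: Q_def)
  have QW: "(x, y) \<in> W" "F (x, y) \<in> ball x0 R" if "x \<in> Q" "y \<in> Q" for x y
    using AB(5) that by (auto simp: Q_def)
  have QV: "x \<in> V" "x \<in> ball x0 R" if "x \<in> Q" for x
    using QW(1)[OF that that] that by (simp_all add: Q_def W_iff)
  have "isCont u 0" using u'[of 0] d by (auto intro: has_vector_derivative_continuous)
  then obtain S where S: "open S" "0 \<in> S" "\<And>t. t \<in> S \<Longrightarrow> u t \<in> Q"
    using Q u0 unfolding continuous_at_open by metis
  then obtain \<delta> where \<delta>: "0 < \<delta>" "ball 0 \<delta> \<subseteq> S" using openE by blast
  \<comment> \<open>The half leaves room for \<open>s + t\<close> inside the solution interval and
    inside the times spent in \<open>Q\<close>; \<open>1 / (2 * L)\<close> is the smallness required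
    for uniqueness.\<close>
  define \<eta> where "\<eta> = min (min d \<delta> / 2) (1 / (2 * L))"
  have \<eta>: "0 < \<eta>" using d \<delta> L by (simp add: \<eta>_def)
  have \<eta>2: "2 * \<eta> \<le> d" "2 * \<eta> \<le> \<delta>" using d \<delta> by (simp_all add: \<eta>_def min_def)
  have \<eta>L: "\<eta> * L \<le> 1 / 2"
  proof -
    have "\<eta> \<le> 1 / (2 * L)" by (simp add: \<eta>_def)
    then show ?thesis using L by (simp add: field_simps)
  qed
  have uQ: "u t \<in> Q" if "\<bar>t\<bar> < 2 * \<eta>" for t
    using S(3) \<delta>(2) that \<eta>2 by (auto simp: subset_iff dist_real_def)
  have u'': "(u has_vector_derivative vf z (u t)) (at t)" if "\<bar>t\<bar> < 2 * \<eta>" for t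
  proof -
    have "t \<in> {-d<..<d}" using that \<eta>2 by auto
    then show ?thesis by (rule u')
  qed
  show thesis
  proof
    show "0 < \<eta>" "u 0 = x0" by fact+
    show "u t \<in> V" "(u has_vector_derivative vf z (u t)) (at t)" if "\<bar>t\<bar> < \<eta>" for t
      using QV(1)[OF uQ, of t] u''[of t] that by simp_all
    fix s t assume s: "\<bar>s\<bar> < \<eta>" and t: "\<bar>t\<bar> < \<eta>"
    have us: "u s \<in> Q" using s by (intro uQ) simp
    have "u (s + t) = F (u s, u t)"
    proof (rule ode_local_uniqueness[OF lip \<eta>L])
      fix r assume "r \<in> {-\<eta><..<\<eta>}"
      then have r: "\<bar>s + r\<bar> < 2 * \<eta>" "\<bar>r\<bar> < 2 * \<eta>" using s by auto
      have "((\<lambda>r. s + r) has_vector_derivative 1) (at r)" by (auto intro!: derivative_eq_intros)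
      from vector_diff_chain_at[OF this u''[OF r(1)]]
      have "((\<lambda>r. u (s + r)) has_vector_derivative vf z (u (s + r))) (at r)"
        by (simp add: o_def)
      then show "u (s + r) \<in> cball x0 R \<and>
          ((\<lambda>r. u (s + r)) has_vector_derivative vf z (u (s + r))) (at r)"
        using QV(2)[OF uQ[OF r(1)]] by simp
      have ur: "u r \<in> Q" using r(2) by (rule uQ)
      show "F (u s, u r) \<in> cball x0 R \<and>
          ((\<lambda>r. F (u s, u r)) has_vector_derivative vf z (F (u s, u r))) (at r)"
        using F_curve[OF QW(1)[OF us ur] u''[OF r(2)]] vf_left_invariant[OF QW(1)[OF us ur]]
          QW(2)[OF us ur] by simp
    qed (use t u0 F_unit(1)[OF QV(1)[OF us]] in auto)
    moreover have "(u s, u t) \<in> W" using t by (intro QW us uQ) simp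
    ultimately show "\<psi> (u (s + t)) = mul (\<psi> (u s)) (\<psi> (u t))" by (simp add: \<psi>_F)
  qed
qed

text \<open>Since \<open>\<gamma> (t + h)\<close> is the left translate of \<open>\<gamma> h\<close>
  by \<open>\<gamma> t\<close>, the derivative at any time \<open>t\<close> spent in the chart is
  the initial velocity moved by the differential of that translation.\<close>

lemma one_param_subgroup_ode:
  assumes \<gamma>: "one_param_subgroup AG mul \<gamma>" "has_velocity AG e \<gamma> Z" and t: "\<gamma> t \<in> fst c"
  shows "((\<lambda>s. \<phi> (\<gamma> s)) has_vector_derivative vf (Z c) (\<phi> (\<gamma> t))) (at t)"
proof -
  have hom: "\<gamma> (t + h) = mul (\<gamma> t) (\<gamma> h)" for h
    using \<gamma>(1) by (simp add: one_param_subgroup_def)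
  have cont: "continuous_on UNIV \<gamma>"
    using \<gamma>(1) by (simp add: one_param_subgroup_def smooth_map_def)
  have \<gamma>0: "\<gamma> 0 = e" and Z: "((\<lambda>s. \<phi> (\<gamma> s)) has_vector_derivative Z c) (at 0)"
    using \<gamma>(2) c by (simp_all add: has_velocity_def)
  have T: "open (\<gamma> -` fst c)" "0 \<in> \<gamma> -` fst c"
    using open_vimage[OF chart(4) cont] chart(3) by (simp_all add: \<gamma>0)
  have "(\<phi> (\<gamma> t), \<phi> (\<gamma> 0)) \<in> W" using t by (simp add: \<gamma>0 W_unit(1))
  from F_curve[where v = "\<lambda>s. \<phi> (\<gamma> s)", OF this Z]
  have "((\<lambda>h. F (\<phi> (\<gamma> t), \<phi> (\<gamma> h))) has_vector_derivative vf (Z c) (\<phi> (\<gamma> t))) (at 0)"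
    by (simp add: vf_def \<gamma>0)
  then have "((\<lambda>h. \<phi> (\<gamma> (t + h))) has_vector_derivative vf (Z c) (\<phi> (\<gamma> t))) (at 0)"
    by (rule has_vector_derivative_transform_within_open[OF _ T]) (simp add: hom F_\<phi> t)
  moreover have "((\<lambda>s. s - t) has_vector_derivative 1) (at t)"
    by (auto intro!: derivative_eq_intros)
  ultimately show ?thesis
    using vector_diff_chain_at[of "\<lambda>s. s - t" 1 t "\<lambda>h. \<phi> (\<gamma> (t + h))"] by (simp add: o_def)
qed

text \<open>The differential equation decides only while both curves stay in the ball where the
  field is Lipschitz; the homomorphism property carries the equality to all times.\<close>

lemma one_param_subgroup_unique:
  assumes "one_param_subgroup AG mul \<gamma>1" "has_velocity AG e \<gamma>1 Z"
    and "one_param_subgroup AG mul \<gamma>2" "has_velocity AG e \<gamma>2 Z"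
  shows "\<gamma>1 = \<gamma>2"
proof -
  obtain R L where R: "0 < R" and L: "0 < L" and lip: "L-lipschitz_on (cball x0 R) (vf (Z c))"
    by (rule vf_locally_lipschitz)
  let ?U = "fst c \<inter> \<phi> -` ball x0 R"
  have U: "open ?U" by (intro continuous_open_preimage chart open_ball)
  have cont: "continuous_on UNIV \<gamma>1" "continuous_on UNIV \<gamma>2"
    using assms by (simp_all add: one_param_subgroup_def smooth_map_def)
  have at0: "\<gamma>1 0 = e" "\<gamma>2 0 = e" using assms by (simp_all add: has_velocity_def)
  have "open (\<gamma>1 -` ?U \<inter> \<gamma>2 -` ?U)" using open_vimage[OF U] cont by blast
  moreover have "0 \<in> \<gamma>1 -` ?U \<inter> \<gamma>2 -` ?U" using R chart(3) by (simp add: at0)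
  ultimately obtain \<delta> where \<delta>: "0 < \<delta>" "ball 0 \<delta> \<subseteq> \<gamma>1 -` ?U \<inter> \<gamma>2 -` ?U" by (rule openE)
  define \<eta> where "\<eta> = min \<delta> (1 / (2 * L))"
  have \<eta>: "0 < \<eta>" "\<eta> \<le> \<delta>" "\<eta> * L \<le> 1 / 2"
  proof -
    have "\<eta> \<le> 1 / (2 * L)" by (simp add: \<eta>_def)
    then show "\<eta> * L \<le> 1 / 2" using L by (simp add: field_simps)
  qed (use \<delta> L in \<open>simp_all add: \<eta>_def\<close>)
  have in_U: "\<gamma>1 t \<in> ?U" "\<gamma>2 t \<in> ?U" if "t \<in> {-\<eta><..<\<eta>}" for t
  proof -
    have "t \<in> ball 0 \<delta>" using that \<eta>(2) by (auto simp: dist_real_def)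
    then show "\<gamma>1 t \<in> ?U" "\<gamma>2 t \<in> ?U" using \<delta>(2) by blast+
  qed
  have "\<phi> (\<gamma>1 t) \<in> cball x0 R \<and>
      ((\<lambda>t. \<phi> (\<gamma>1 t)) has_vector_derivative vf (Z c) (\<phi> (\<gamma>1 t))) (at t)"
    and "\<phi> (\<gamma>2 t) \<in> cball x0 R \<and>
      ((\<lambda>t. \<phi> (\<gamma>2 t)) has_vector_derivative vf (Z c) (\<phi> (\<gamma>2 t))) (at t)"
    if "t \<in> {-\<eta><..<\<eta>}" for t
    using in_U[OF that] one_param_subgroup_ode[OF assms(1,2)] one_param_subgroup_ode[OF assms(3,4)]
    by simp_all
  note ode = this
  have "\<gamma>1 t = \<gamma>2 t" if "\<bar>t\<bar> < \<eta>" for t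
  proof -
    have t: "t \<in> {-\<eta><..<\<eta>}" using that by auto
    have "\<phi> (\<gamma>1 0) = \<phi> (\<gamma>2 0)" by (simp add: at0)
    from ode_local_uniqueness[OF lip \<eta>(3) ode this t] have "\<phi> (\<gamma>1 t) = \<phi> (\<gamma>2 t)" .
    moreover have "\<psi> (\<phi> (\<gamma>1 t)) = \<gamma>1 t" "\<psi> (\<phi> (\<gamma>2 t)) = \<gamma>2 t"
      using in_U[OF t] \<psi>_\<phi> by blast+
    ultimately show ?thesis by metis
  qed
  then show ?thesis
    using assms eq_of_eq_near_0[of \<gamma>1 mul \<gamma>2 \<eta>] \<eta>(1) by (simp add: one_param_subgroup_def)
qed

text \<open>Doubling is purely algebraic and gives no regularity. On the neighbourhood
  \<open>N s\<close> of each time, however, \<open>\<gamma> t\<close> is the product of the fixed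
  element \<open>\<gamma> s\<close> and the smooth local solution at \<open>t - s\<close>.\<close>

lemma one_param_subgroup_exists:
  assumes Z: "Z \<in> tangent_space AG e"
  obtains \<gamma> where "one_param_subgroup AG mul \<gamma>" "has_velocity AG e \<gamma> Z"
proof -
  obtain \<eta> u where \<eta>: "0 < \<eta>" and u0: "u 0 = x0"
    and uV: "\<And>t. \<bar>t\<bar> < \<eta> \<Longrightarrow> u t \<in> V"
    and u': "\<And>t. \<bar>t\<bar> < \<eta> \<Longrightarrow> (u has_vector_derivative vf (Z c) (u t)) (at t)"
    and u_hom: "\<And>s t. \<bar>s\<bar> < \<eta> \<Longrightarrow> \<bar>t\<bar> < \<eta> \<Longrightarrow> \<psi> (u (s + t)) = mul (\<psi> (u s)) (\<psi> (u t))"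
    by (rule local_one_parameter_group[of "Z c"]) blast
  obtain \<gamma> where hom: "\<And>s t. \<gamma> (s + t) = mul (\<gamma> s) (\<gamma> t)"
    and \<gamma>: "\<And>t. \<bar>t\<bar> < \<eta> \<Longrightarrow> \<gamma> t = \<psi> (u t)"
    by (rule extend_local_homomorphism[of mul \<eta> "\<lambda>t. \<psi> (u t)", OF assoc \<eta> u_hom]) blast+
  let ?I = "{-\<eta><..<\<eta>}"
  have smooth_u: "smooth_on ?I u"
    by (rule ode_solution_smooth[OF _ smooth_vf[of "Z c"]]) (use uV u' in auto)
  define N where "N s = {s - \<eta><..<s + \<eta>}" for s
  have N: "open (N s)" "s \<in> N s" for s using \<eta> by (auto simp: N_def)
  have N_I: "(\<lambda>t. t - s) ` N s \<subseteq> ?I" for s by (auto simp: N_def)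
  have C_u: "C_on k (N s) (\<lambda>t. u (t - s))" for k s
  proof (rule C_on_compose[OF N(1) N_I])
    show "C_on k ?I u" using smooth_u unfolding smooth_on_def by blast
    show "C_on k (N s) (\<lambda>t. t - s)"
      using C_on_add[OF N(1) C_on_ident[OF N(1)] C_on_const[OF N(1)], of k s "- s"] by simp
  qed
  have \<gamma>_local: "\<gamma> t = mul (\<gamma> s) (\<psi> (u (t - s)))" if "t \<in> N s" for s t
  proof -
    have "\<gamma> (s + (t - s)) = mul (\<gamma> s) (\<gamma> (t - s))" by (rule hom)
    then show ?thesis using \<gamma>[of "t - s"] that by (auto simp: N_def)
  qed
  have uN: "u (t - s) \<in> V" if "t \<in> N s" for s t
    using uV[of "t - s"] that by (auto simp: N_def)
  \<comment> \<open>Continuity is settled before smoothness, since it makes the preimages of chart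
    domains open, as the calculus of \<open>C_on\<close> requires.\<close>
  have "isCont \<gamma> s" for s
  proof -
    have "continuous_on (N s) (\<lambda>t. u (t - s))" using C_u[of 0 s] by simp
    then have "continuous_on (N s) (\<lambda>t. \<psi> (u (t - s)))"
      by (rule continuous_on_compose2[OF chart(7)]) (use uN in blast)
    then have "continuous_on (N s) (\<lambda>t. (\<gamma> s, \<psi> (u (t - s))))"
      by (intro continuous_on_Pair continuous_on_const)
    from continuous_on_compose2[OF continuous_mul this]
    have "continuous_on (N s) (\<lambda>t. mul (\<gamma> s) (\<psi> (u (t - s))))" by simp
    then have "continuous_on (N s) \<gamma>" using \<gamma>_local by (simp cong: continuous_on_cong)
    then show ?thesis using N by (simp add: continuous_on_eq_continuous_at)
  qed
  then have cont: "continuous_on UNIV \<gamma>" by (simp add: continuous_at_imp_continuous_on)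
  have "smooth_on (\<gamma> -` fst d) (snd d \<circ> \<gamma>)" if d: "d \<in> AG" for d
    unfolding smooth_on_def
  proof (intro allI C_on_local)
    fix k s assume s: "s \<in> \<gamma> -` fst d"
    have "open (fst d)" using manifold d by (simp add: smooth_manifold_def is_chart_def)
    then have op: "open (N s \<inter> \<gamma> -` fst d)" using cont N(1) by (intro open_Int open_vimage)
    have "smooth_map AG AG (\<lambda>y. mul (\<gamma> s) y)"
      using smooth_map_section[OF manifold manifold manifold, of "\<lambda>(a, b). mul a b" "\<gamma> s"] lie
      by (simp add: lie_group_def)
    then have sm: "smooth_on (\<phi> ` (fst c \<inter> (\<lambda>y. mul (\<gamma> s) y) -` fst d))
        (snd d \<circ> (\<lambda>y. mul (\<gamma> s) y) \<circ> \<psi>)" (is "smooth_on ?S ?g")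
      using d chart(2) unfolding smooth_map_def by blast
    have sub: "(\<lambda>t. u (t - s)) ` (N s \<inter> \<gamma> -` fst d) \<subseteq> ?S"
    proof (intro subsetI, elim imageE)
      fix x t assume x: "x = u (t - s)" and t: "t \<in> N s \<inter> \<gamma> -` fst d"
      then have "x \<in> V" "mul (\<gamma> s) (\<psi> x) \<in> fst d" using uN \<gamma>_local by auto
      then show "x \<in> ?S" unfolding chart_image_Int[OF chart(1)] by simp
    qed
    have "C_on k ?S ?g" using sm unfolding smooth_on_def by blast
    from C_on_compose[OF op sub C_on_subset[OF C_u Int_lower1] this]
    have "C_on k (N s \<inter> \<gamma> -` fst d) (\<lambda>t. ?g (u (t - s)))" .
    then have "C_on k (N s \<inter> \<gamma> -` fst d) (snd d \<circ> \<gamma>)"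
      by (rule C_on_cong[OF op, rotated]) (simp add: \<gamma>_local[symmetric])
    then show "\<exists>T. open T \<and> s \<in> T \<and> C_on k T (snd d \<circ> \<gamma>)" using op s N(2) by blast
  qed
  then have "smooth_map vector_atlas AG \<gamma>" using cont by (simp add: smooth_curve_iff)
  then have sub: "one_param_subgroup AG mul \<gamma>" using hom by (simp add: one_param_subgroup_def)
  have "has_velocity AG e \<gamma> Z"
  proof (rule has_velocityI_chart[OF manifold c Z])
    show "\<gamma> 0 = e" using \<gamma>[of 0] \<eta> by (simp add: u0 \<psi>_x0)
    show "isCont \<gamma> 0" using cont by (simp add: continuous_on_eq_continuous_at)
    have "(u has_vector_derivative Z c) (at 0)" using u'[of 0] \<eta> by (simp add: u0 vf_unit)
    then show "((\<lambda>s. \<phi> (\<gamma> s)) has_vector_derivative Z c) (at 0)"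
      by (rule has_vector_derivative_transform_within_open[where S = ?I])
        (use \<eta> uV in \<open>auto simp: \<gamma> \<phi>_\<psi> abs_less_iff\<close>)
  qed
  with sub show thesis by (rule that)
qed

end

section \<open>Rescaling of time and the exponential curve\<close>

lemma one_param_subgroup_rescale:
  assumes A: "smooth_manifold A"
    and \<gamma>: "one_param_subgroup A mul \<gamma>" "has_velocity A e \<gamma> Z"
  shows "one_param_subgroup A mul (\<lambda>s. \<gamma> (t * s))"
    and "has_velocity A e (\<lambda>s. \<gamma> (t * s)) (scale_tangent t Z)"
proof -
  have cont: "continuous_on UNIV \<gamma>" and sm: "\<And>d. d \<in> A \<Longrightarrow> smooth_on (\<gamma> -` fst d) (snd d \<circ> \<gamma>)"
    and hom: "\<And>s t. \<gamma> (s + t) = mul (\<gamma> s) (\<gamma> t)"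
    using \<gamma>(1) by (simp_all add: one_param_subgroup_def smooth_curve_iff)
  have cont': "continuous_on UNIV (\<lambda>s. \<gamma> (t * s))"
    by (rule continuous_on_compose2[OF cont]) (auto intro: continuous_intros)
  have "smooth_on ((\<lambda>s. \<gamma> (t * s)) -` fst d) (snd d \<circ> (\<lambda>s. \<gamma> (t * s)))" if d: "d \<in> A" for d
    unfolding smooth_on_def
  proof
    fix k
    have "open (fst d)" using A d by (simp add: smooth_manifold_def is_chart_def)
    then have op: "open ((\<lambda>s. \<gamma> (t * s)) -` fst d)" using cont' by (rule open_vimage)
    have lin: "C_on k ((\<lambda>s. \<gamma> (t * s)) -` fst d) (\<lambda>s. t * s)"
      using C_on_scaleR[OF op C_on_const[OF op] C_on_ident[OF op], of k t] by simp
    have "C_on k (\<gamma> -` fst d) (snd d \<circ> \<gamma>)" using sm[OF d] unfolding smooth_on_def by blast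
    from C_on_compose[OF op _ lin this]
    show "C_on k ((\<lambda>s. \<gamma> (t * s)) -` fst d) (snd d \<circ> (\<lambda>s. \<gamma> (t * s)))" by (auto simp: o_def)
  qed
  then have "smooth_map vector_atlas A (\<lambda>s. \<gamma> (t * s))" using cont' by (simp add: smooth_curve_iff)
  then show "one_param_subgroup A mul (\<lambda>s. \<gamma> (t * s))"
    using hom by (simp add: one_param_subgroup_def distrib_left)
  have "((\<lambda>s. snd d (\<gamma> (t * s))) has_vector_derivative t *\<^sub>R Z d) (at 0)"
    if "d \<in> charts_at A e" for d
  proof -
    have "((\<lambda>s. snd d (\<gamma> s)) has_vector_derivative Z d) (at (t * 0))"
      using \<gamma>(2) that by (simp add: has_velocity_def)
    moreover have "((\<lambda>s. t * s) has_vector_derivative t) (at 0)"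
      by (auto intro!: derivative_eq_intros)
    ultimately show ?thesis
      using vector_diff_chain_at[of "\<lambda>s. t * s" t 0 "\<lambda>s. snd d (\<gamma> s)"] by (simp add: o_def)
  qed
  moreover have "scale_tangent t Z \<in> tangent_space A e"
    using \<gamma>(2) by (intro scale_tangent_in_tangent_space[OF A]) (simp add: has_velocity_def)
  moreover have "isCont (\<lambda>s. \<gamma> (t * s)) 0" using cont' by (simp add: continuous_on_eq_continuous_at)
  ultimately show "has_velocity A e (\<lambda>s. \<gamma> (t * s)) (scale_tangent t Z)"
    using \<gamma>(2) by (simp add: has_velocity_def scale_tangent_def)
qed

text \<open>By uniqueness the subgroup with velocity \<open>s Z\<close> is
  \<open>r \<mapsto> \<gamma> (s * r)\<close>, whose value at time 1 is \<open>\<gamma> s\<close>.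
  The exponential curve is thus \<open>\<gamma>\<close> itself. Used both for \<open>X m\<close> and
  for the values of \<open>Y\<close>.\<close>

lemma lie_exp_curve:
  assumes lie: "lie_group AG mul e ginv" and Z: "Z \<in> tangent_space AG e"
  shows "has_velocity AG e (\<lambda>s. lie_exp AG mul e (scale_tangent s Z)) Z"
proof -
  have man: "smooth_manifold AG" using lie by (simp add: lie_group_def)
  obtain c where c: "c \<in> charts_at AG e" using charts_at_nonempty[OF man] by blast
  interpret lie_group_chart AG mul e ginv c using lie c by unfold_locales
  obtain \<gamma> where \<gamma>: "one_param_subgroup AG mul \<gamma>" "has_velocity AG e \<gamma> Z"
    using one_param_subgroup_exists[OF Z] .
  have "lie_exp AG mul e (scale_tangent s Z) = \<gamma> s" for s
  proof -
    note \<gamma>s = one_param_subgroup_rescale[OF man \<gamma>, of s]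
    have "(THE \<beta>. one_param_subgroup AG mul \<beta> \<and> has_velocity AG e \<beta> (scale_tangent s Z)) =
        (\<lambda>r. \<gamma> (s * r))"
      using \<gamma>s one_param_subgroup_unique[OF _ _ \<gamma>s] by (intro the_equality) blast+
    then show ?thesis by (simp add: lie_exp_def)
  qed
  then show ?thesis using \<gamma>(2) by simp
qed

text \<open>The first conjunct gives \<open>velocity\<close> its meaning at every \<open>t\<close>;
  the second asserts that the outer derivative exists and is a Lie algebra element, beyond naming
  its value.\<close>

theorem mainTheorem4:
  fixes AM :: "('m::{t2_space,second_countable_topology}, 'b::euclidean_model) chart set"
    and AG :: "('g::{t2_space,second_countable_topology}, 'c::euclidean_model) chart set"
    and mul :: "'g \<Rightarrow> 'g \<Rightarrow> 'g" and e :: 'g and ginv :: "'g \<Rightarrow> 'g"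
    and act :: "'m \<Rightarrow> 'g \<Rightarrow> 'm"
    and X Y :: "'m \<Rightarrow> ('g, 'c) chart \<Rightarrow> 'c" and m :: 'm
  assumes "smooth_manifold AM"
    and "lie_group AG mul e ginv"
    and "smooth_right_action AM AG mul e act"
    and "X \<in> smooth_tangent_maps AM AG e"
    and "Y \<in> smooth_tangent_maps AM AG e"
  shows "(\<forall>t. \<exists>v. has_velocity AG e
            (\<lambda>s. rhd_group act (exp_map AG mul e (scale_map t X)) (exp_map AG mul e (scale_map s Y)) m) v)
       \<and> has_deriv_in_tangent_space AG e
            (\<lambda>t. velocity AG e
              (\<lambda>s. rhd_group act (exp_map AG mul e (scale_map t X)) (exp_map AG mul e (scale_map s Y)) m))
            (rhd_lie AG mul e act X Y m)"
proof -
  have man: "smooth_manifold AG" using assms(2) by (simp add: lie_group_def)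
  have X: "X m' \<in> tangent_space AG e" and Y: "Y m' \<in> tangent_space AG e" for m'
    using assms(4,5) by (simp_all add: smooth_tangent_maps_def)
  define \<gamma> where "\<gamma> t = lie_exp AG mul e (scale_tangent t (X m))" for t
  have \<gamma>: "has_velocity AG e \<gamma> (X m)"
    unfolding \<gamma>_def using assms(2) X by (rule lie_exp_curve)
  \<comment> \<open>For fixed \<open>t\<close> the inner curve is
    \<open>s \<mapsto> exp (s Z)\<close> with \<open>Z\<close> the value of \<open>Y\<close> at the
    point \<open>act m (\<gamma> t)\<close>, so \<open>y t\<close> is the inner derivative.\<close>
  define y where "y t = Y (act m (\<gamma> t))" for t
  have vel: "has_velocity AG e (\<lambda>s. rhd_group act (exp_map AG mul e (scale_map t X))
      (exp_map AG mul e (scale_map s Y)) m) (y t)" for t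
    unfolding rhd_group_def exp_map_def scale_map_def y_def \<gamma>_def
    using assms(2) Y by (rule lie_exp_curve)
  have rhd: "rhd_lie AG mul e act X Y m d = vector_derivative (\<lambda>t. y t d) (at 0)" for d
    by (simp add: rhd_lie_def assoc_vector_field_def y_def \<gamma>_def)
  have y: "y t \<in> tangent_space AG e" for t unfolding y_def by (rule Y)
  \<comment> \<open>The right-hand side is a \<open>vector_derivative\<close>, so what remains is
    differentiability of \<open>y\<close> at 0, by the chain rule through the orbit map and a
    component of \<open>Y\<close>.\<close>
  have deriv: "((\<lambda>t. y t d) has_vector_derivative rhd_lie AG mul e act X Y m d) (at 0)"
    if d: "d \<in> charts_at AG e" for d
  proof -
    have \<gamma>0: "\<gamma> 0 = e" "isCont \<gamma> 0" using \<gamma> by (simp_all add: has_velocity_def)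
    have "smooth_map AG AM (\<lambda>a. act m a)"
      using smooth_map_section[OF assms(1) man assms(1), of "\<lambda>(m, a). act m a" m] assms(3)
      by (simp add: smooth_right_action_def)
    note act = this
    have Yd: "smooth_map AM vector_atlas (\<lambda>m. Y m d)"
      using assms(5) d by (simp add: smooth_tangent_maps_def)
    obtain a where a: "a \<in> charts_at AM (act m e)" using charts_at_nonempty[OF assms(1)] by blast
    have "(\<lambda>t. snd d (\<gamma> t)) differentiable (at 0)"
      using \<gamma> d unfolding has_velocity_def by (blast intro: differentiableI_vector)
    then have "(\<lambda>t. snd a (act m (\<gamma> t))) differentiable (at 0)"
      using d a \<gamma>0 charts_at_is_chart[OF man d]
      by (intro differentiable_smooth_map_curve[OF _ _ _ _ _ act]) (simp_all add: charts_at_def)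
    moreover have "isCont (\<lambda>a. act m a) (\<gamma> 0)"
      using act by (simp add: smooth_map_def continuous_on_eq_continuous_at)
    then have "isCont (\<lambda>t. act m (\<gamma> t)) 0" by (rule isCont_o2[OF \<gamma>0(2)])
    \<comment> \<open>The model space is a manifold with the single chart \<open>(UNIV, id)\<close>;
      the identity is written out so that the chain rule for manifolds applies.\<close>
    ultimately have "(\<lambda>t. snd (UNIV :: 'c set, id) (Y (act m (\<gamma> t)) d)) differentiable (at 0)"
      using a \<gamma>0(1) charts_at_is_chart[OF assms(1) a]
      by (intro differentiable_smooth_map_curve[OF _ _ _ _ _ Yd,
            where \<gamma> = "\<lambda>t. act m (\<gamma> t)" and c = a and d = "(UNIV, id)"])
        (simp_all add: charts_at_def vector_atlas_def)
    then show ?thesis by (simp add: rhd y_def vector_derivative_works)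
  qed
  \<comment> \<open>Each \<open>y t\<close> obeys the transition rule at the fixed point
    \<open>e\<close>, whose linear map does not depend on \<open>t\<close>; differentiating in
    \<open>t\<close> preserves the rule.\<close>
  have "rhd_lie AG mul e act X Y m d =
      frechet_derivative (snd d \<circ> chart_inv c) (at (snd c e)) (rhd_lie AG mul e act X Y m c)"
    if c: "c \<in> charts_at AG e" and d: "d \<in> charts_at AG e" for c d
  proof -
    let ?D = "frechet_derivative (snd d \<circ> chart_inv c) (at (snd c e))"
    have "bounded_linear ?D"
      using transition_has_derivative[OF man c d] by (rule has_derivative_bounded_linear)
    from bounded_linear.has_vector_derivative[OF this deriv[OF c]]
    have "((\<lambda>t. y t d) has_vector_derivative ?D (rhd_lie AG mul e act X Y m c)) (at 0)"
      by (simp only: tangent_space_transition[OF y c d, symmetric])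
    then show ?thesis by (rule vector_derivative_unique_at[OF deriv[OF d]])
  qed
  \<comment> \<open>In a chart not containing \<open>e\<close> the components of all
    \<open>y t\<close> are 0, and so is their derivative.\<close>
  moreover have "rhd_lie AG mul e act X Y m d = 0" if "d \<notin> charts_at AG e" for d
    by (simp add: rhd tangent_space_outside[OF y that])
  ultimately have "rhd_lie AG mul e act X Y m \<in> tangent_space AG e"
    unfolding tangent_space_def by (intro CollectI conjI allI impI ballI)
  then have "has_deriv_in_tangent_space AG e y (rhd_lie AG mul e act X Y m)"
    using y deriv unfolding has_deriv_in_tangent_space_def by blast
  then show ?thesis unfolding velocity_eq[OF vel] using vel by blast
qed

end
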